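(* Let $\Gamma$ be a countable group, let $\mathfrak X$ be a Cantor set, and let $(\mathfrak X,\Gamma,\Phi)$ be an effective minimal equicontinuous action. Fix any point $x\in\mathfrak X$ and any adapted neighborhood basis $\mathcal U$ at $x$; in (2)–(5) all types of wildness are understood with respect to $(x,\mathcal U)$. Then: \begin{enumerate} \item Each of the properties "countably wild of finite type", "countably wild of flat type", "countably dynamically wild" is an invariant of the conjugacy class of the action. That is, if $(\mathfrak X',\Gamma,\Psi)$ is an action conjugate to $(\mathfrak X,\Gamma,\Phi)$, and $\mathcal U'$ is an adapted neighborhood basis for $\Psi$ at a point $x'\in\mathfrak X'$, then $(\mathfrak X,\Gamma,\Phi)$ has the given property with respect to $(x,\mathcal U)$ if and only if $(\mathfrak X',\Gamma,\Psi)$ has it with respect to $(x',\mathcal U')$. \item If $(\mathfrak X,\Gamma,\Phi)$ is countably wild of flat type, then the germinal groupoid $\mathcal G(\mathfrak X,\Gamma,\Phi)$ has Hausdorff topology. \item If $\Gamma$ has a non-Hausdorff element, then $(\mathfrak X,\Gamma,\Phi)$ is countably dynamically wild. \item If $(\mathfrak X,\Gamma,\Phi)$ is countably dynamically wild, then $(\mathfrak X,\Gamma,\Phi)$ is dynamically wild. \item If $(\mathfrak X,\Gamma,\Phi)$ is wild of finite type (resp. wild of flat type), then either the action $(\mathfrak X,\Gamma,\Phi)$ is locally quasi-analytic (LQA), or it is countably wild of finite type (resp. countably wild of flat type). \end{enumerate}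
   Context: A Cantor set is a compact totally disconnected metrizable space without isolated points. An action $(\mathfrak X,\Gamma,\Phi)$ is a homomorphism $\Phi:\Gamma\to\mathrm{Homeo}(\mathfrak X)$; write $g\cdot x=\Phi(g)(x)$. It is minimal if every orbit is dense; equicontinuous if for a metric $d$ compatible with the topology, for every $\epsilon>0$ there is $\delta>0$ with $d(x,y)<\delta\Rightarrow d(g\cdot x,g\cdot y)<\epsilon$ for all $g\in\Gamma$; effective if $\Phi$ is injective. Actions $(\mathfrak X,\Gamma,\Phi)$ and $(\mathfrak X',\Gamma,\Psi)$ are conjugate if there is a homeomorphism $h:\mathfrak X'\to\mathfrak X$ with $h(\Psi(g)(z))=\Phi(g)(h(z))$ for all $z\in\mathfrak X'$, $g\in\Gamma$. Adapted sets. A nonempty clopen set $U\subset\mathfrak X$ is adapted if for every $g\in\Gamma$ either $g\cdot U=U$ or $g\cdot U\cap U=\emptyset$. An adapted neighborhood basis at $x$ is a properly descending chain $\mathcal U=\{U_\ell\mid \ell\ge 0\}$ of adapted clopen sets with $U_0=\mathfrak X$, $x\in U_\ell$ for all $\ell$, and $\bigcap_\ell U_\ell=\{x\}$. Put $\Gamma_\ell=\{g\in\Gamma\mid g\cdot U_\ell=U_\ell\}$. LQA. An action of a group $G$ (countable or profinite) on $\mathfrak X$ is locally quasi-analytic (LQA) if there is $\varepsilon>0$ such that for every adapted set $U$ with $\mathrm{diam}(U)<\varepsilon$, every adapted $V\subset U$ and all $g_1,g_2\in G$: if $g_1|_V=g_2|_V$ then $g_1|_U=g_2|_U$. Profinite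 closure. $\mathfrak G(\Phi)$ is the closure of $\Phi(\Gamma)$ in $\mathrm{Homeo}(\mathfrak X)$ in the uniform topology (a profinite group acting on $\mathfrak X$); $\Gamma$ is identified with its image $\Phi(\Gamma)\subset\mathfrak G(\Phi)$. Put $\mathcal D_x=\{\widehat g\in\mathfrak G(\Phi)\mid \widehat g\cdot x=x\}$ and let $\widehat\Gamma_\ell$ be the closure of $\Gamma_\ell$ in $\mathfrak G(\Phi)$. The action $(\mathfrak X,\Gamma,\Phi)$ is stable if the action of $\mathfrak G(\Phi)$ on $\mathfrak X$ is LQA, and wild otherwise. Profinite stabilizer and centralizer groups: $K_\ell=\{\widehat h\in\mathcal D_x\mid[\widehat h,\widehat g]\in\mathcal D_x\ \forall\,\widehat g\in\widehat\Gamma_\ell\}$, $Z_\ell=\{\widehat h\in\mathcal D_x\mid[\widehat h,\widehat g]=\mathrm{id}\ \forall\,\widehat g\in\widehat\Gamma_\ell\}$. These are increasing chains with $Z_\ell\subset K_\ell$; $\Upsilon_s$ and $\Upsilon_c$ are the direct limits of $\{K_\ell\}$ and $\{Z_\ell\}$ with respect to inclusions. Countable stabilizer and centralizer groups: with $\mathcal K=\bigcap_{\ell\ge0}\Gamma_\ell=\{g\in\Gamma\mid g\cdot x=x\}$, set $K^\Gamma_\ell=\{h\in\mathcal K\mid[h,g]\in\mathcal K\ \forall g\in\Gamma_\ell\}$, $Z^\Gamma_\ell=\{h\in\mathcal K\mid[h,g]=\mathrm{id}\ \forall g\in\Gamma_\ell\}$; $\Upsilon^\Gamma_s$ and $\Upsilon^\Gamma_c$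 are the direct limits of the increasing chains $\{K_\ell^\Gamma\}$, $\{Z_\ell^\Gamma\}$ with respect to inclusions. A direct limit of an increasing chain of groups is bounded if there is $k$ such that the inclusions from level $\ell$ to level $\ell'$ are isomorphisms for all $\ell'\ge\ell\ge k$; otherwise unbounded. A wild action is: wild of finite type if $\Upsilon_s$ is unbounded and all $K_\ell$ are finite; wild of flat type if $\Upsilon_s$ is unbounded and $\Upsilon_c=\Upsilon_s$ (i.e. the inclusion $\Upsilon_c\to\Upsilon_s$ is an isomorphism); dynamically wild if $\Upsilon_s$ is unbounded and the action is not of flat type. If the action of $\Gamma$ on $\mathfrak X$ is not LQA, it is: countably wild of finite type if $\Upsilon^\Gamma_s$ is unbounded and all $K_\ell^\Gamma$ are finite; countably wild of flat type if $\Upsilon^\Gamma_s$ is unbounded and $\Upsilon^\Gamma_c=\Upsilon^\Gamma_s$ (the inclusion is an isomorphism); countably dynamically wild if $\Upsilon_s^\Gamma$ is unbounded and the action is not countably wild of flat type. Germinal groupoid. For $g\in\Gamma$ and $y\in\mathfrak X$, the germ $[g]_y$ is the class of $g$ under: $g_1\sim_y g_2$ iff $g_1\cdot y=g_2\cdot y$ and $g_1|_U=g_2|_U$ for some open neighborhood $U$ of $y$. $\mathcal G(\mathfrak X,\Gamma,\Phi)=\{[g]_y\mid g\in\Gamma,\ y\in\mathfrak X\}$ with the sheaf topology, with basis the sets $\{[g]_y\mid y\in U\}$, $g\in\Gamma$, $U\subset\mathfrak X$ open. An element $g\in\Gamma$ is non-Hausdorff at $y$ if $g\cdot y=y$, $g$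 is not the identity on any open neighborhood of $y$, and every neighborhood $W$ of $y$ contains a nonempty open set $O$ with $g|_O=\mathrm{id}$. It is a non-Hausdorff element if it is non-Hausdorff at some $y\in\mathfrak X$. *)

theory Defs
  imports "HOL-Analysis.Analysis" "HOL-Algebra.Group_Action"
begin

section \<open>Cantor sets and actions\<close>

definition totally_disconnected_space :: "'a topology \<Rightarrow> bool" where
  "totally_disconnected_space X \<longleftrightarrow> (\<forall>S. connectedin X S \<longrightarrow> (\<exists>a. S \<subseteq> {a}))"

definition cantor_space :: "'a topology \<Rightarrow> bool" where
  "cantor_space X \<longleftrightarrow>
     compact_space X \<and> totally_disconnected_space X \<and> metrizable_space X \<and>
     (\<forall>y\<in>topspace X. \<not> openin X {y})"

text \<open>Homeomorphisms are normalised to be extensional (equal to \<^const>\<open>undefined\<close> off the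
  space), as in \<^const>\<open>BijGroup\<close>, so that equality in the group is equality of maps on the space.\<close>

definition homeo_group :: "'a topology \<Rightarrow> ('a \<Rightarrow> 'a) monoid" where
  "homeo_group X =
     (BijGroup (topspace X))\<lparr>carrier := {f \<in> Bij (topspace X). homeomorphic_map X X f}\<rparr>"

definition top_action ::
    "('g, 'm) monoid_scheme \<Rightarrow> 'a topology \<Rightarrow> ('g \<Rightarrow> 'a \<Rightarrow> 'a) \<Rightarrow> bool" where
  "top_action G X \<Phi> \<longleftrightarrow> group G \<and> \<Phi> \<in> hom G (homeo_group X)"

definition effective_action :: "('g, 'm) monoid_scheme \<Rightarrow> ('g \<Rightarrow> 'a \<Rightarrow> 'a) \<Rightarrow> bool" where
  "effective_action G \<Phi> \<longleftrightarrow> inj_on \<Phi> (carrier G)"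

definition minimal_action ::
    "('g, 'm) monoid_scheme \<Rightarrow> 'a topology \<Rightarrow> ('g \<Rightarrow> 'a \<Rightarrow> 'a) \<Rightarrow> bool" where
  "minimal_action G X \<Phi> \<longleftrightarrow> (\<forall>y\<in>topspace X. X closure_of (orbit G \<Phi> y) = topspace X)"

definition equicontinuous_action ::
    "('g, 'm) monoid_scheme \<Rightarrow> 'a topology \<Rightarrow> ('g \<Rightarrow> 'a \<Rightarrow> 'a) \<Rightarrow> bool" where
  "equicontinuous_action G X \<Phi> \<longleftrightarrow>
     (\<exists>d. mtopology_of d = X \<and>
        (\<forall>\<epsilon>>0. \<exists>\<delta>>0. \<forall>y\<in>topspace X. \<forall>z\<in>topspace X. mdist d y z < \<delta> \<longrightarrow>
           (\<forall>g\<in>carrier G. mdist d (\<Phi> g y) (\<Phi> g z) < \<epsilon>)))"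

definition conjugate_actions ::
    "('g, 'm) monoid_scheme \<Rightarrow> 'a topology \<Rightarrow> ('g \<Rightarrow> 'a \<Rightarrow> 'a) \<Rightarrow>
       'c topology \<Rightarrow> ('g \<Rightarrow> 'c \<Rightarrow> 'c) \<Rightarrow> bool" where
  "conjugate_actions G X \<Phi> X' \<Psi> \<longleftrightarrow>
     (\<exists>h. homeomorphic_map X' X h \<and>
        (\<forall>z\<in>topspace X'. \<forall>g\<in>carrier G. h (\<Psi> g z) = \<Phi> g (h z)))"


section \<open>Adapted sets and local quasi-analyticity\<close>

definition adapted_set ::
    "('g, 'm) monoid_scheme \<Rightarrow> 'a topology \<Rightarrow> ('g \<Rightarrow> 'a \<Rightarrow> 'a) \<Rightarrow> 'a set \<Rightarrow> bool" where
  "adapted_set G X \<Phi> U \<longleftrightarrow>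
     U \<noteq> {} \<and> openin X U \<and> closedin X U \<and>
     (\<forall>g\<in>carrier G. \<Phi> g ` U = U \<or> \<Phi> g ` U \<inter> U = {})"

definition adapted_nbhd_basis ::
    "('g, 'm) monoid_scheme \<Rightarrow> 'a topology \<Rightarrow> ('g \<Rightarrow> 'a \<Rightarrow> 'a) \<Rightarrow> 'a \<Rightarrow> (nat \<Rightarrow> 'a set) \<Rightarrow> bool"
  where
  "adapted_nbhd_basis G X \<Phi> x U \<longleftrightarrow>
     U 0 = topspace X \<and>
     (\<forall>l. adapted_set G X \<Phi> (U l) \<and> x \<in> U l \<and> U (Suc l) \<subset> U l) \<and>
     (\<Inter>l. U l) = {x}"

definition set_stabilizer ::
    "('g, 'm) monoid_scheme \<Rightarrow> ('g \<Rightarrow> 'a \<Rightarrow> 'a) \<Rightarrow> 'a set \<Rightarrow> 'g set" where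
  "set_stabilizer G \<Phi> U = {g \<in> carrier G. \<Phi> g ` U = U}"

definition mdiameter :: "'a metric \<Rightarrow> 'a set \<Rightarrow> real" where
  "mdiameter d S = (if S = {} then 0 else SUP (y, z)\<in>S \<times> S. mdist d y z)"

definition lqa :: "'a metric \<Rightarrow> ('g, 'm) monoid_scheme \<Rightarrow> ('g \<Rightarrow> 'a \<Rightarrow> 'a) \<Rightarrow> bool" where
  "lqa d G \<Phi> \<longleftrightarrow>
     (\<exists>\<epsilon>>0. \<forall>U V.
        adapted_set G (mtopology_of d) \<Phi> U \<and> mdiameter d U < \<epsilon> \<and>
        adapted_set G (mtopology_of d) \<Phi> V \<and> V \<subseteq> U \<longrightarrow>
        (\<forall>g1\<in>carrier G. \<forall>g2\<in>carrier G.
           (\<forall>y\<in>V. \<Phi> g1 y = \<Phi> g2 y) \<longrightarrow> (\<forall>y\<in>U. \<Phi> g1 y = \<Phi> g2 y)))"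


section \<open>The profinite closure\<close>

text \<open>\<^const>\<open>cfunspace\<close> carries the supremum metric, so this is the topology of uniform
  convergence on the homeomorphism group.\<close>

definition uniform_topology :: "'a metric \<Rightarrow> ('a \<Rightarrow> 'a) topology" where
  "uniform_topology d =
     subtopology (mtopology_of (cfunspace (mtopology_of d) d))
       (carrier (homeo_group (mtopology_of d)))"

definition profinite_closure ::
    "'a metric \<Rightarrow> ('g, 'm) monoid_scheme \<Rightarrow> ('g \<Rightarrow> 'a \<Rightarrow> 'a) \<Rightarrow> ('a \<Rightarrow> 'a) monoid" where
  "profinite_closure d G \<Phi> =
     (homeo_group (mtopology_of d))
       \<lparr>carrier := uniform_topology d closure_of (\<Phi> ` carrier G)\<rparr>"

definition profinite_level ::
    "'a metric \<Rightarrow> ('g, 'm) monoid_scheme \<Rightarrow> ('g \<Rightarrow> 'a \<Rightarrow> 'a) \<Rightarrow> (nat \<Rightarrow> 'a set) \<Rightarrow>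
       nat \<Rightarrow> ('a \<Rightarrow> 'a) set" where
  "profinite_level d G \<Phi> U l =
     subtopology (uniform_topology d) (carrier (profinite_closure d G \<Phi>))
       closure_of (\<Phi> ` set_stabilizer G \<Phi> (U l))"

text \<open>The profinite closure acts on the space by evaluation, i.e. through \<open>\<lambda>f. f\<close>.\<close>

definition stable_action ::
    "'a metric \<Rightarrow> ('g, 'm) monoid_scheme \<Rightarrow> ('g \<Rightarrow> 'a \<Rightarrow> 'a) \<Rightarrow> bool" where
  "stable_action d G \<Phi> \<longleftrightarrow> lqa d (profinite_closure d G \<Phi>) (\<lambda>f. f)"


section \<open>Stabilizer and centralizer groups, and their direct limits\<close>

text \<open>The following notions are stated for an action \<open>a\<close> of a group \<open>A\<close> and a decreasing chain
  \<open>C\<close> of subsets of \<open>A\<close>.  They are used below in two instances: \<open>A = \<Gamma>\<close> with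
  \<open>C l = \<Gamma>\<^sub>l\<close>, and \<open>A\<close> the profinite closure with \<open>C l\<close> the closure of \<open>\<Gamma>\<^sub>l\<close>.\<close>

definition group_commutator :: "('g, 'm) monoid_scheme \<Rightarrow> 'g \<Rightarrow> 'g \<Rightarrow> 'g" where
  "group_commutator A h g = h \<otimes>\<^bsub>A\<^esub> g \<otimes>\<^bsub>A\<^esub> inv\<^bsub>A\<^esub> h \<otimes>\<^bsub>A\<^esub> inv\<^bsub>A\<^esub> g"

definition stab_level ::
    "('g, 'm) monoid_scheme \<Rightarrow> ('g \<Rightarrow> 'a \<Rightarrow> 'a) \<Rightarrow> 'a \<Rightarrow> (nat \<Rightarrow> 'g set) \<Rightarrow> nat \<Rightarrow> 'g set" where
  "stab_level A a x C l =
     {h \<in> stabilizer A a x. \<forall>g\<in>C l. group_commutator A h g \<in> stabilizer A a x}"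

definition cent_level ::
    "('g, 'm) monoid_scheme \<Rightarrow> ('g \<Rightarrow> 'a \<Rightarrow> 'a) \<Rightarrow> 'a \<Rightarrow> (nat \<Rightarrow> 'g set) \<Rightarrow> nat \<Rightarrow> 'g set" where
  "cent_level A a x C l =
     {h \<in> stabilizer A a x. \<forall>g\<in>C l. group_commutator A h g = \<one>\<^bsub>A\<^esub>}"

text \<open>The direct limit of an increasing chain of subgroups with respect to the inclusions is
  realised as its union.\<close>

definition chain_limit :: "('g, 'm) monoid_scheme \<Rightarrow> (nat \<Rightarrow> 'g set) \<Rightarrow> ('g, 'm) monoid_scheme"
  where "chain_limit A K = A\<lparr>carrier := (\<Union>l. K l)\<rparr>"

definition chain_bounded :: "('g, 'm) monoid_scheme \<Rightarrow> (nat \<Rightarrow> 'g set) \<Rightarrow> bool" where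
  "chain_bounded A K \<longleftrightarrow>
     (\<exists>k. \<forall>l\<ge>k. \<forall>l'\<ge>l. (\<lambda>h. h) \<in> iso (A\<lparr>carrier := K l\<rparr>) (A\<lparr>carrier := K l'\<rparr>))"

definition finite_type_chain ::
    "('g, 'm) monoid_scheme \<Rightarrow> ('g \<Rightarrow> 'a \<Rightarrow> 'a) \<Rightarrow> 'a \<Rightarrow> (nat \<Rightarrow> 'g set) \<Rightarrow> bool" where
  "finite_type_chain A a x C \<longleftrightarrow>
     \<not> chain_bounded A (stab_level A a x C) \<and> (\<forall>l. finite (stab_level A a x C l))"

definition flat_type_chain ::
    "('g, 'm) monoid_scheme \<Rightarrow> ('g \<Rightarrow> 'a \<Rightarrow> 'a) \<Rightarrow> 'a \<Rightarrow> (nat \<Rightarrow> 'g set) \<Rightarrow> bool" where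
  "flat_type_chain A a x C \<longleftrightarrow>
     \<not> chain_bounded A (stab_level A a x C) \<and>
     (\<lambda>h. h) \<in> iso (chain_limit A (cent_level A a x C)) (chain_limit A (stab_level A a x C))"

definition dynamical_type_chain ::
    "('g, 'm) monoid_scheme \<Rightarrow> ('g \<Rightarrow> 'a \<Rightarrow> 'a) \<Rightarrow> 'a \<Rightarrow> (nat \<Rightarrow> 'g set) \<Rightarrow> bool" where
  "dynamical_type_chain A a x C \<longleftrightarrow>
     \<not> chain_bounded A (stab_level A a x C) \<and> \<not> flat_type_chain A a x C"


section \<open>Types of wildness\<close>

definition wild_finite_type ::
    "'a metric \<Rightarrow> ('g, 'm) monoid_scheme \<Rightarrow> ('g \<Rightarrow> 'a \<Rightarrow> 'a) \<Rightarrow> 'a \<Rightarrow> (nat \<Rightarrow> 'a set) \<Rightarrow> bool" where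
  "wild_finite_type d G \<Phi> x U \<longleftrightarrow>
     \<not> stable_action d G \<Phi> \<and>
     finite_type_chain (profinite_closure d G \<Phi>) (\<lambda>f. f) x (profinite_level d G \<Phi> U)"

definition wild_flat_type ::
    "'a metric \<Rightarrow> ('g, 'm) monoid_scheme \<Rightarrow> ('g \<Rightarrow> 'a \<Rightarrow> 'a) \<Rightarrow> 'a \<Rightarrow> (nat \<Rightarrow> 'a set) \<Rightarrow> bool" where
  "wild_flat_type d G \<Phi> x U \<longleftrightarrow>
     \<not> stable_action d G \<Phi> \<and>
     flat_type_chain (profinite_closure d G \<Phi>) (\<lambda>f. f) x (profinite_level d G \<Phi> U)"

definition dynamically_wild ::
    "'a metric \<Rightarrow> ('g, 'm) monoid_scheme \<Rightarrow> ('g \<Rightarrow> 'a \<Rightarrow> 'a) \<Rightarrow> 'a \<Rightarrow> (nat \<Rightarrow> 'a set) \<Rightarrow> bool" where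
  "dynamically_wild d G \<Phi> x U \<longleftrightarrow>
     \<not> stable_action d G \<Phi> \<and>
     dynamical_type_chain (profinite_closure d G \<Phi>) (\<lambda>f. f) x (profinite_level d G \<Phi> U)"

definition countably_wild_finite_type ::
    "'a metric \<Rightarrow> ('g, 'm) monoid_scheme \<Rightarrow> ('g \<Rightarrow> 'a \<Rightarrow> 'a) \<Rightarrow> 'a \<Rightarrow> (nat \<Rightarrow> 'a set) \<Rightarrow> bool" where
  "countably_wild_finite_type d G \<Phi> x U \<longleftrightarrow>
     \<not> lqa d G \<Phi> \<and> finite_type_chain G \<Phi> x (\<lambda>l. set_stabilizer G \<Phi> (U l))"

definition countably_wild_flat_type ::
    "'a metric \<Rightarrow> ('g, 'm) monoid_scheme \<Rightarrow> ('g \<Rightarrow> 'a \<Rightarrow> 'a) \<Rightarrow> 'a \<Rightarrow> (nat \<Rightarrow> 'a set) \<Rightarrow> bool" where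
  "countably_wild_flat_type d G \<Phi> x U \<longleftrightarrow>
     \<not> lqa d G \<Phi> \<and> flat_type_chain G \<Phi> x (\<lambda>l. set_stabilizer G \<Phi> (U l))"

definition countably_dynamically_wild ::
    "'a metric \<Rightarrow> ('g, 'm) monoid_scheme \<Rightarrow> ('g \<Rightarrow> 'a \<Rightarrow> 'a) \<Rightarrow> 'a \<Rightarrow> (nat \<Rightarrow> 'a set) \<Rightarrow> bool" where
  "countably_dynamically_wild d G \<Phi> x U \<longleftrightarrow>
     \<not> lqa d G \<Phi> \<and> dynamical_type_chain G \<Phi> x (\<lambda>l. set_stabilizer G \<Phi> (U l))"


section \<open>The germinal groupoid and non-Hausdorff elements\<close>

definition germ_rel ::
    "('g, 'm) monoid_scheme \<Rightarrow> 'a topology \<Rightarrow> ('g \<Rightarrow> 'a \<Rightarrow> 'a) \<Rightarrow> (('g \<times> 'a) \<times> ('g \<times> 'a)) set" where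
  "germ_rel G X \<Phi> =
     {((g1, y), (g2, y')). g1 \<in> carrier G \<and> g2 \<in> carrier G \<and> y \<in> topspace X \<and> y' = y \<and>
        \<Phi> g1 y = \<Phi> g2 y \<and> (\<exists>U. openin X U \<and> y \<in> U \<and> (\<forall>z\<in>U. \<Phi> g1 z = \<Phi> g2 z))}"

text \<open>Classes are taken of pairs \<open>(g, y)\<close>, so that germs at different points are different.\<close>

definition germ ::
    "('g, 'm) monoid_scheme \<Rightarrow> 'a topology \<Rightarrow> ('g \<Rightarrow> 'a \<Rightarrow> 'a) \<Rightarrow> 'g \<Rightarrow> 'a \<Rightarrow> ('g \<times> 'a) set" where
  "germ G X \<Phi> g y = germ_rel G X \<Phi> `` {(g, y)}"

text \<open>The sets below cover exactly the germs \<open>[g]\<^sub>y\<close>, so the \<^const>\<open>topspace\<close> is the set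
  of all germs.\<close>

definition germinal_groupoid_topology ::
    "('g, 'm) monoid_scheme \<Rightarrow> 'a topology \<Rightarrow> ('g \<Rightarrow> 'a \<Rightarrow> 'a) \<Rightarrow> ('g \<times> 'a) set topology" where
  "germinal_groupoid_topology G X \<Phi> =
     topology_generated_by {germ G X \<Phi> g ` U | g U. g \<in> carrier G \<and> openin X U}"

definition non_Hausdorff_at ::
    "('g, 'm) monoid_scheme \<Rightarrow> 'a topology \<Rightarrow> ('g \<Rightarrow> 'a \<Rightarrow> 'a) \<Rightarrow> 'g \<Rightarrow> 'a \<Rightarrow> bool" where
  "non_Hausdorff_at G X \<Phi> g y \<longleftrightarrow>
     \<Phi> g y = y \<and>
     \<not> (\<exists>U. openin X U \<and> y \<in> U \<and> (\<forall>z\<in>U. \<Phi> g z = z)) \<and>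
     (\<forall>W. openin X W \<and> y \<in> W \<longrightarrow>
        (\<exists>S. openin X S \<and> S \<noteq> {} \<and> S \<subseteq> W \<and> (\<forall>z\<in>S. \<Phi> g z = z)))"

definition non_Hausdorff_element ::
    "('g, 'm) monoid_scheme \<Rightarrow> 'a topology \<Rightarrow> ('g \<Rightarrow> 'a \<Rightarrow> 'a) \<Rightarrow> 'g \<Rightarrow> bool" where
  "non_Hausdorff_element G X \<Phi> g \<longleftrightarrow>
     g \<in> carrier G \<and> (\<exists>y\<in>topspace X. non_Hausdorff_at G X \<Phi> g y)"

end

theory Submission
  imports Defs
begin

text \<open>
  The theorem rests on a description of the stabilizer chain that does not mention the base point.
  If \<open>h\<close> fixes \<open>x\<close>, then the commutator \<open>[h, g\<inverse>]\<close> fixes \<open>x\<close> if and only if \<open>h\<close> fixes \<open>g x\<close>.  By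
  minimality the orbit of \<open>x\<close> under the stabilizer of \<open>U\<^sub>l\<close> is dense in \<open>U\<^sub>l\<close>, so \<open>K\<^sub>l\<close> is exactly the
  group of all \<open>h\<close> that are the identity on \<open>U\<^sub>l\<close> (\<open>stab_level_eq_fixator\<close>).  Since every nonempty
  open set contains a translate of some \<open>U\<^sub>l\<close>, conjugation shows that each of the properties in
  question depends only on the pointwise stabilizers (fixators) of open sets:
  \<^item> the chain \<open>K\<close> is bounded if and only if some nonempty open \<open>W\<close> has the same fixator as all
    its nonempty open subsets, and this is also equivalent to the action being LQA
    (\<open>K_bounded_iff_bounded_fixators\<close>, \<open>lqa_iff_bounded_fixators\<close>);
  \<^item> all \<open>K\<^sub>l\<close> are finite if and only if all fixators of nonempty open sets are finite
    (\<open>K_finite_iff_finite_fixators\<close>);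
  \<^item> the limits of \<open>Z\<close> and \<open>K\<close> agree if and only if every \<open>h\<close> that is the identity on a nonempty open
    set commutes with the stabilizer of some adapted subset of it (\<open>flat_iff_flat_fixators\<close>).

  Invariance under conjugacy and change of base point follows.  The third equivalence
  needs the fact that for an adapted set \<open>V\<close> every point \<open>y\<close> is interior to the closure of its
  orbit under the stabilizer of \<open>V\<close> (\<open>stab_orbit_closure_nbhd\<close>): this stabilizer has
  finite index, so finitely many translates of that closure cover the space.

  The same fact settles the statements about non-Hausdorff elements.  Let \<open>h\<close> be non-Hausdorff at \<open>y\<close>.
  If the action were flat, \<open>h\<close> would commute with the stabilizer of an adapted set, hence fix the
  orbit of \<open>y\<close> under it, hence a neighbourhood of \<open>y\<close>.  If the chain were bounded, \<open>h\<close> would be the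
  identity on a whole translate of \<open>U\<^sub>k\<close> around \<open>y\<close>.  Both contradict the choice of \<open>h\<close>.  Two germs
  that cannot be separated yield a non-Hausdorff element, which gives the Hausdorff property of
  the groupoid.

  Finally, \<open>U\<close> is an adapted neighbourhood basis also for the action of the profinite
  closure, and the closure of the stabilizer of \<open>U\<^sub>l\<close> is the stabilizer of \<open>U\<^sub>l\<close> in the profinite
  closure, because a uniform limit moves points across a clopen set exactly as its close approximants do
  (\<open>adapted_in_P\<close>, \<open>profinite_level_eq\<close>).  So the description above holds for both groups, and
  boundedness, finiteness and flatness visibly pass from the profinite closure to its subgroup.
\<close>

text \<open>
  The algebra library uses the same syntax \<open>closure_of\<close> for congruences; here it always denotes
  topological closure.
\<close>

no_notation eq_closure_of ("closure'_of\<index>")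

section \<open>Group actions by homeomorphisms\<close>

text \<open>
  A group acting by homeomorphisms.  Each element acts as a map that is \<^const>\<open>undefined\<close> outside of
  the space, so statements about the action are restricted to points of the space.
\<close>

locale homeo_action = group A for A (structure) +
  fixes X :: "'a topology" and a :: "_ \<Rightarrow> 'a \<Rightarrow> 'a"
  assumes top_action: "top_action A X a"
begin

text \<open>
  The pointwise stabilizer of a set \<open>V\<close>.
\<close>

definition fixator :: "'a set \<Rightarrow> _ set"
  where "fixator V = {h \<in> carrier A. \<forall>y\<in>V. a h y = y}"

abbreviation stab :: "'a set \<Rightarrow> _ set"
  where "stab V \<equiv> set_stabilizer A a V"

abbreviation adapted :: "'a set \<Rightarrow> bool"
  where "adapted V \<equiv> adapted_set A X a V"

lemma homeo: "g \<in> carrier A \<Longrightarrow> homeomorphic_map X X (a g)"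
  using top_action by (auto simp: top_action_def homeo_group_def hom_def)

lemma Bij: "g \<in> carrier A \<Longrightarrow> a g \<in> Bij (topspace X)"
  using top_action by (auto simp: top_action_def homeo_group_def hom_def)

lemma act_closed: "g \<in> carrier A \<Longrightarrow> y \<in> topspace X \<Longrightarrow> a g y \<in> topspace X"
  using Bij Bij_imp_funcset by blast

lemma act_mult:
  assumes "g \<in> carrier A" "h \<in> carrier A" "y \<in> topspace X"
  shows "a (g \<otimes> h) y = a g (a h y)"
proof -
  have "a (g \<otimes> h) = a g \<otimes>\<^bsub>BijGroup (topspace X)\<^esub> a h"
    using top_action assms by (auto simp: top_action_def homeo_group_def hom_def)
  then show ?thesis
    using assms Bij by (simp add: BijGroup_def compose_def)
qed

lemma act_one: "y \<in> topspace X \<Longrightarrow> a \<one> y = y"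
  using act_mult [of \<one> \<one> y] Bij [of \<one>] act_closed [of \<one> y]
  by (auto simp: Bij_def bij_betw_def inj_on_eq_iff)

lemma act_inv1: "g \<in> carrier A \<Longrightarrow> y \<in> topspace X \<Longrightarrow> a (inv g) (a g y) = y"
  by (metis act_mult act_one inv_closed l_inv)

lemma act_inv2: "g \<in> carrier A \<Longrightarrow> y \<in> topspace X \<Longrightarrow> a g (a (inv g) y) = y"
  by (metis act_mult act_one inv_closed r_inv)

lemma act_inj: "\<lbrakk>g \<in> carrier A; y \<in> topspace X; z \<in> topspace X\<rbrakk> \<Longrightarrow> a g y = a g z \<longleftrightarrow> y = z"
  by (metis act_inv1)

lemma image_mult:
  assumes "g \<in> carrier A" "h \<in> carrier A" "V \<subseteq> topspace X"
  shows "a (g \<otimes> h) ` V = a g ` a h ` V"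
  using assms by (force simp: act_mult image_iff subset_iff)

lemma image_one: "V \<subseteq> topspace X \<Longrightarrow> a \<one> ` V = V"
  by (force simp: act_one image_iff subset_iff)

lemma image_subset: "g \<in> carrier A \<Longrightarrow> V \<subseteq> topspace X \<Longrightarrow> a g ` V \<subseteq> topspace X"
  using act_closed by blast

lemma image_inv1: "g \<in> carrier A \<Longrightarrow> V \<subseteq> topspace X \<Longrightarrow> a (inv g) ` a g ` V = V"
  by (metis image_mult image_one inv_closed l_inv)

lemma image_inv2: "g \<in> carrier A \<Longrightarrow> V \<subseteq> topspace X \<Longrightarrow> a g ` a (inv g) ` V = V"
  by (metis image_mult image_one inv_closed r_inv)

lemma open_image: "g \<in> carrier A \<Longrightarrow> openin X V \<Longrightarrow> openin X (a g ` V)"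
  using homeo homeomorphic_map_openness_eq by blast

lemma closed_image: "g \<in> carrier A \<Longrightarrow> closedin X V \<Longrightarrow> closedin X (a g ` V)"
  using homeo homeomorphic_map_closedness_eq by blast

lemma fixator_antimono: "V \<subseteq> W \<Longrightarrow> fixator W \<subseteq> fixator V"
  by (auto simp: fixator_def)

lemma fixator_translate:
  assumes "h \<in> fixator V" "g \<in> carrier A" "V \<subseteq> topspace X"
  shows "g \<otimes> h \<otimes> inv g \<in> fixator (a g ` V)"
  using assms by (auto simp: fixator_def act_mult act_inv1 act_closed subset_iff)

lemma fixator_translate_back:
  assumes "h \<in> fixator (a g ` V)" "g \<in> carrier A" "V \<subseteq> topspace X"
  shows "inv g \<otimes> h \<otimes> g \<in> fixator V"
  using fixator_translate [of h "a g ` V" "inv g"] assms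
  by (simp add: image_inv1 image_subset)

text \<open>
  Comparing two elements on \<open>V\<close> amounts to a membership in the fixator of \<open>V\<close>.
\<close>

lemma fixator_diff:
  assumes "g \<in> carrier A" "h \<in> carrier A" "V \<subseteq> topspace X"
  shows "inv h \<otimes> g \<in> fixator V \<longleftrightarrow> (\<forall>y\<in>V. a g y = a h y)"
proof -
  have "a (inv h \<otimes> g) y = y \<longleftrightarrow> a g y = a h y" if "y \<in> V" for y
  proof -
    have y: "y \<in> topspace X" using that assms by blast
    show ?thesis
      using assms y by (metis act_closed act_inv1 act_inv2 act_mult inv_closed)
  qed
  then show ?thesis
    using assms by (simp add: fixator_def)
qed

lemma adapted_subset: "adapted V \<Longrightarrow> V \<subseteq> topspace X"
  by (simp add: adapted_set_def openin_subset)

text \<open>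
  An element that moves a single point of an adapted set within the set stabilizes the set.
\<close>

lemma adapted_stab:
  "\<lbrakk>adapted V; g \<in> carrier A; y \<in> V; a g y \<in> V\<rbrakk> \<Longrightarrow> g \<in> stab V"
  unfolding adapted_set_def set_stabilizer_def by blast

lemma stab_subgroup:
  assumes "V \<subseteq> topspace X"
  shows "subgroup (stab V) A"
proof
  fix g assume g: "g \<in> stab V"
  then have "a (inv g) ` a g ` V = V"
    using image_inv1 [OF _ assms, of g] g unfolding set_stabilizer_def by blast
  then show "inv g \<in> stab V"
    using g by (simp add: set_stabilizer_def)
qed (use assms in \<open>auto simp: set_stabilizer_def image_mult image_one\<close>)

lemma stab_conj:
  assumes "g \<in> carrier A" "V \<subseteq> topspace X" "k \<in> stab (a g ` V)"
  shows "inv g \<otimes> k \<otimes> g \<in> stab V"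
  using assms by (simp add: set_stabilizer_def image_mult image_subset image_inv1)

lemma stab_conj':
  assumes "g \<in> carrier A" "V \<subseteq> topspace X" "k \<in> stab V"
  shows "g \<otimes> k \<otimes> inv g \<in> stab (a g ` V)"
  using assms by (simp add: set_stabilizer_def image_mult image_subset image_inv1)

lemma stab_mono:
  assumes "adapted V" "adapted W" "V \<subseteq> W"
  shows "stab V \<subseteq> stab W"
proof
  fix g assume g: "g \<in> stab V"
  obtain v where "v \<in> V" using assms by (auto simp: adapted_set_def)
  then have "a g v \<in> V" using g by (auto simp: set_stabilizer_def)
  then show "g \<in> stab W"
    using adapted_stab [OF assms(2), of g v] \<open>v \<in> V\<close> assms(3) g
    by (auto simp: set_stabilizer_def)
qed

lemma adapted_translate:
  assumes V: "adapted V" and g: "g \<in> carrier A"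
  shows "adapted (a g ` V)"
proof -
  have VX: "V \<subseteq> topspace X" using V by (rule adapted_subset)
  have "a k ` a g ` V = a g ` V" if k: "k \<in> carrier A" "a k ` a g ` V \<inter> a g ` V \<noteq> {}" for k
  proof -
    obtain v w where vw: "v \<in> V" "w \<in> V" "a k (a g v) = a g w" using k(2) by blast
    have "a (inv g \<otimes> k \<otimes> g) v = w"
      using vw VX k(1) g by (auto simp: act_mult act_closed act_inv1 subset_iff)
    then have "inv g \<otimes> k \<otimes> g \<in> stab V"
      using adapted_stab [OF V, of "inv g \<otimes> k \<otimes> g" v] vw k(1) g by auto
    then have "g \<otimes> (inv g \<otimes> k \<otimes> g) \<otimes> inv g \<in> stab (a g ` V)"
      using stab_conj' g VX by blast
    moreover have "g \<otimes> (inv g \<otimes> k \<otimes> g) \<otimes> inv g = k"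
      using g k(1) by (simp add: m_assoc inv_solve_right) (simp flip: m_assoc)
    ultimately show ?thesis by (simp add: set_stabilizer_def)
  qed
  then show ?thesis
    using V g unfolding adapted_set_def by (meson closed_image image_is_empty open_image)
qed

end

lemma ex_interior_of_finite_closed_cover:
  assumes "finite F" "\<And>S. S \<in> F \<Longrightarrow> closedin X S" "X interior_of (\<Union>F) \<noteq> {}"
  shows "\<exists>S\<in>F. X interior_of S \<noteq> {}"
  using assms
proof (induction F)
  case (insert S F)
  then show ?case
    by (auto simp: interior_of_union_eq_empty)
qed auto


section \<open>Minimal actions\<close>

text \<open>
  A minimal action on a compact Hausdorff space.
\<close>

locale minimal_homeo_action = homeo_action +
  assumes compact: "compact_space X" and hausdorff: "Hausdorff_space X"
    and minimal: "minimal_action A X a"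
begin

lemma orbit_meets_open:
  assumes "y \<in> topspace X" "openin X V" "V \<noteq> {}"
  obtains g where "g \<in> carrier A" "a g y \<in> V"
proof -
  obtain v where v: "v \<in> V" using assms by blast
  then have "v \<in> X closure_of orbit A a y"
    using assms minimal openin_subset by (fastforce simp: minimal_action_def)
  then obtain z where "z \<in> orbit A a y" "z \<in> V"
    using v assms(2) unfolding in_closure_of by blast
  then show thesis
    using that unfolding orbit_def by blast
qed

text \<open>
  By compactness an adapted set has finitely many translates; equivalently its stabilizer has
  finite index.
\<close>

lemma finite_translates_cover:
  assumes V: "adapted V"
  obtains F where "finite F" "F \<subseteq> carrier A" "\<And>g. g \<in> carrier A \<Longrightarrow> \<exists>f\<in>F. inv f \<otimes> g \<in> stab V"
    "topspace X = (\<Union>f\<in>F. a f ` V)"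
proof -
  let ?T = "(\<lambda>g. a g ` V) ` carrier A"
  have VX: "V \<subseteq> topspace X" "openin X V" "V \<noteq> {}"
    using V adapted_subset by (auto simp: adapted_set_def)
  have "\<exists>g\<in>carrier A. y \<in> a g ` V" if y: "y \<in> topspace X" for y
  proof -
    obtain g where g: "g \<in> carrier A" "a g y \<in> V"
      using orbit_meets_open y VX by metis
    then have "y \<in> a (inv g) ` V"
      using y act_inv1 by (metis image_eqI)
    with g show ?thesis by blast
  qed
  then have "topspace X \<subseteq> \<Union>?T" by blast
  moreover have "\<And>W. W \<in> ?T \<Longrightarrow> openin X W" using VX open_image by blast
  ultimately obtain \<F> where "finite \<F>" "\<F> \<subseteq> ?T" "topspace X \<subseteq> \<Union>\<F>"
    using compact unfolding compact_space_alt by metis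
  then obtain F where F: "finite F" "F \<subseteq> carrier A" "topspace X \<subseteq> (\<Union>f\<in>F. a f ` V)"
    by (metis finite_subset_image)
  have "\<exists>f\<in>F. inv f \<otimes> g \<in> stab V" if g: "g \<in> carrier A" for g
  proof -
    obtain v where v: "v \<in> V" using VX by blast
    then have "a g v \<in> topspace X" using g VX act_closed by blast
    then obtain f w where f: "f \<in> F" "w \<in> V" "a g v = a f w" using F by blast
    moreover have fA: "f \<in> carrier A" using f F by blast
    ultimately have "a (inv f \<otimes> g) v = w"
      using v VX g by (auto simp: act_mult act_inv1 subset_iff)
    then have "inv f \<otimes> g \<in> stab V"
      using adapted_stab [OF V, of "inv f \<otimes> g" v] v f fA g by auto
    with f show ?thesis by blast
  qed
  moreover have "topspace X = (\<Union>f\<in>F. a f ` V)"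
    using F act_closed VX by blast
  ultimately show thesis using that F by blast
qed

text \<open>
  Finitely many translates of the closure of the \<open>stab V\<close>-orbit of \<open>y\<close> cover the space, so this
  closure has nonempty interior, and by invariance under \<open>stab V\<close> the point \<open>y\<close> itself is interior.
\<close>

lemma stab_orbit_closure_nbhd:
  assumes V: "adapted V" and y: "y \<in> topspace X"
  obtains W where "openin X W" "y \<in> W" "W \<subseteq> X closure_of ((\<lambda>g. a g y) ` stab V)"
proof -
  let ?O = "(\<lambda>g. a g y) ` stab V"
  have sub: "subgroup (stab V) A" using V adapted_subset stab_subgroup by blast
  have stA: "stab V \<subseteq> carrier A" by (auto simp: set_stabilizer_def)
  have OX: "?O \<subseteq> topspace X" using stA act_closed y by blast
  obtain F where F: "finite F" "F \<subseteq> carrier A"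
    "\<And>g. g \<in> carrier A \<Longrightarrow> \<exists>f\<in>F. inv f \<otimes> g \<in> stab V"
    using finite_translates_cover [OF V] by metis
  have "orbit A a y \<subseteq> (\<Union>f\<in>F. a f ` ?O)"
  proof
    fix z assume "z \<in> orbit A a y"
    then obtain g where g: "g \<in> carrier A" "z = a g y" by (auto simp: orbit_def)
    then obtain f where f: "f \<in> F" "inv f \<otimes> g \<in> stab V" using F by blast
    then have fA: "f \<in> carrier A" using F by blast
    have "a f (a (inv f \<otimes> g) y) = z"
      using g fA y by (simp add: act_mult act_inv2 act_closed)
    then show "z \<in> (\<Union>f\<in>F. a f ` ?O)" using f by blast
  qed
  then have "topspace X \<subseteq> X closure_of (\<Union>f\<in>F. a f ` ?O)"
    using minimal y closure_of_mono unfolding minimal_action_def by metis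
  also have "\<dots> = \<Union>((\<lambda>f. X closure_of (a f ` ?O)) ` F)"
    using F(1) by (subst closure_of_Union) auto
  also have "\<dots> = \<Union>((\<lambda>f. a f ` (X closure_of ?O)) ` F)"
    using F(2) OX homeo by (intro arg_cong [of _ _ Union] image_cong refl homeomorphic_map_closure_of) auto
  finally have "topspace X \<subseteq> \<Union>((\<lambda>f. a f ` (X closure_of ?O)) ` F)" .
  moreover have "a f ` (X closure_of ?O) \<subseteq> topspace X" if "f \<in> F" for f
    using that F(2) by (intro image_subset closure_of_subset_topspace) auto
  ultimately have "\<Union>((\<lambda>f. a f ` (X closure_of ?O)) ` F) = topspace X" by blast
  then have "X interior_of \<Union>((\<lambda>f. a f ` (X closure_of ?O)) ` F) \<noteq> {}"
    using y by (metis empty_iff interior_of_topspace)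
  moreover have "closedin X (a f ` (X closure_of ?O))" if "f \<in> F" for f
    using that F(2) by (intro closed_image closedin_closure_of) auto
  ultimately obtain f where f: "f \<in> F" "X interior_of (a f ` (X closure_of ?O)) \<noteq> {}"
    using ex_interior_of_finite_closed_cover [of "(\<lambda>f. a f ` (X closure_of ?O)) ` F" X] F(1)
    by blast
  then have fA: "f \<in> carrier A" using F by blast
  have "X interior_of (a f ` (X closure_of ?O)) = a f ` (X interior_of (X closure_of ?O))"
    using homeomorphic_map_interior_of [OF homeo [OF fA]] closure_of_subset_topspace by metis
  with f obtain z where z: "z \<in> X interior_of (X closure_of ?O)" by blast
  \<comment> \<open>The interior meets the orbit of \<open>y\<close>; moving it back by an element of \<open>stab V\<close> puts \<open>y\<close> inside.\<close>
  define I where "I = X interior_of (X closure_of ?O)"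
  have I: "openin X I" "I \<subseteq> X closure_of ?O" "z \<in> I"
    using z by (auto simp: I_def interior_of_subset)
  then obtain g where g: "g \<in> stab V" "a g y \<in> I"
    by (force simp: in_closure_of)
  have gA: "g \<in> carrier A" "inv g \<in> carrier A" using g stA by auto
  have "a (inv g) ` ?O \<subseteq> ?O"
  proof clarify
    fix k assume k: "k \<in> stab V"
    then have "inv g \<otimes> k \<in> stab V" "k \<in> carrier A"
      using subgroup.m_inv_closed [OF sub g(1)] subgroup.m_closed [OF sub] stA by auto
    then show "a (inv g) (a k y) \<in> ?O"
      using act_mult [OF gA(2) _ y, of k] by (intro image_eqI [of _ _ "inv g \<otimes> k"]) auto
  qed
  then have "X closure_of (a (inv g) ` ?O) \<subseteq> X closure_of ?O"
    by (rule closure_of_mono)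
  then have "a (inv g) ` (X closure_of ?O) \<subseteq> X closure_of ?O"
    unfolding homeomorphic_map_closure_of [OF homeo [OF gA(2)] OX] .
  then have "a (inv g) ` I \<subseteq> X closure_of ?O" using I by blast
  moreover have "openin X (a (inv g) ` I)" using open_image gA I by blast
  moreover have "y \<in> a (inv g) ` I" using g(2) gA y act_inv1 by (metis image_eqI)
  ultimately show thesis using that by blast
qed

end

section \<open>Properties of fixators independent of a base point\<close>

context homeo_action
begin

text \<open>
  Some nonempty open set \<open>W\<close> has the same fixator as all its nonempty open subsets.
\<close>

definition bounded_fixators :: bool
  where "bounded_fixators \<longleftrightarrow>
    (\<exists>W. openin X W \<and> W \<noteq> {} \<and> (\<forall>V. openin X V \<and> V \<noteq> {} \<and> V \<subseteq> W \<longrightarrow> fixator V \<subseteq> fixator W))"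

text \<open>
  For each nonempty open set, only finitely many elements are the identity on it.
\<close>

definition finite_fixators :: bool
  where "finite_fixators \<longleftrightarrow> (\<forall>V. openin X V \<and> V \<noteq> {} \<longrightarrow> finite (fixator V))"

text \<open>
  This is the analogue, without a base point, of the equality of the centralizer and stabilizer
  limits.  The adapted set \<open>B\<close> may be anywhere in \<open>V\<close>, and may depend on \<open>h\<close>.
\<close>

definition flat_fixators :: bool
  where "flat_fixators \<longleftrightarrow>
    (\<forall>V h. openin X V \<and> V \<noteq> {} \<and> h \<in> fixator V \<longrightarrow>
      (\<exists>B\<subseteq>V. adapted B \<and> (\<forall>g\<in>stab B. h \<otimes> g = g \<otimes> h)))"

end

section \<open>The stabilizer and centralizer chains at a base point\<close>

text \<open>
  A minimal action with a base point \<open>x\<close> and an adapted neighbourhood basis \<open>U\<close> at \<open>x\<close>; the chains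
  \<open>K\<close> and \<open>Z\<close> are those of the stabilizers of the sets \<open>U l\<close>.
\<close>

locale based_homeo_action = minimal_homeo_action +
  fixes x :: 'c and U :: "nat \<Rightarrow> 'c set"
  assumes basis: "adapted_nbhd_basis A X a x U"
begin

abbreviation K :: "nat \<Rightarrow> _ set"
  where "K \<equiv> stab_level A a x (\<lambda>l. stab (U l))"

abbreviation Z :: "nat \<Rightarrow> _ set"
  where "Z \<equiv> cent_level A a x (\<lambda>l. stab (U l))"

lemma basis_adapted: "adapted (U l)"
  and basis_point: "x \<in> U l"
  using basis by (auto simp: adapted_nbhd_basis_def)

lemma basis_open: "openin X (U l)"
  using basis_adapted by (auto simp: adapted_set_def)

lemma basis_subset: "U l \<subseteq> topspace X"
  using basis_open openin_subset by blast

lemma basis_nonempty: "U l \<noteq> {}"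
  using basis_point by blast

lemma base_in_space: "x \<in> topspace X"
  using basis_point basis_subset by blast

lemma basis_decseq: "decseq U"
  using basis by (intro decseq_SucI) (auto simp: adapted_nbhd_basis_def)

lemma basis_antimono: "k \<le> l \<Longrightarrow> U l \<subseteq> U k"
  using basis_decseq by (auto simp: decseq_def)

text \<open>
  By compactness, since the intersection of the decreasing closed sets \<open>U k\<close> is the base point.
\<close>

lemma basis_shrinks:
  assumes "openin X W" "x \<in> W"
  obtains k where "U k \<subseteq> W"
proof (rule ccontr)
  assume "\<not> thesis"
  then have ne: "\<And>k. U k - W \<noteq> {}" using that by blast
  have "(\<Inter>k. U k - W) \<noteq> {}"
  proof (rule compact_space_imp_nest [OF compact])
    show "closedin X (U k - W)" for k
      using basis_adapted [of k] assms by (auto simp: adapted_set_def closedin_diff)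
    show "decseq (\<lambda>k. U k - W)"
      using basis_decseq by (auto simp: decseq_def)
  qed (rule ne)
  then show False
    using basis assms by (auto simp: adapted_nbhd_basis_def)
qed

lemma translate_into_open:
  assumes "openin X V" "V \<noteq> {}"
  obtains g k where "g \<in> carrier A" "a g x \<in> V" "\<And>l. l \<ge> k \<Longrightarrow> a g ` U l \<subseteq> V"
proof -
  obtain g where g: "g \<in> carrier A" "a g x \<in> V"
    using orbit_meets_open [OF base_in_space assms] by blast
  have VX: "V \<subseteq> topspace X" using assms openin_subset by blast
  have "x \<in> a (inv g) ` V"
    using g base_in_space act_inv1 by (metis image_eqI)
  then obtain k where k: "U k \<subseteq> a (inv g) ` V"
    using basis_shrinks [of "a (inv g) ` V"] open_image [of "inv g" V] g assms by auto
  have "a g ` U l \<subseteq> V" if "l \<ge> k" for l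
  proof -
    have "a g ` U l \<subseteq> a g ` a (inv g) ` V"
      using k basis_antimono [OF that] by (intro image_mono) blast
    then show ?thesis
      using image_inv2 g VX by simp
  qed
  with g show thesis using that by blast
qed

lemma stab_orbit_dense:
  "U l \<subseteq> X closure_of ((\<lambda>g. a g x) ` stab (U l))"
proof
  fix y assume y: "y \<in> U l"
  have "\<exists>z. z \<in> (\<lambda>g. a g x) ` stab (U l) \<and> z \<in> T" if T: "y \<in> T" "openin X T" for T
  proof -
    obtain g where g: "g \<in> carrier A" "a g x \<in> T \<inter> U l"
      using orbit_meets_open [OF base_in_space, of "T \<inter> U l"] T y basis_open by blast
    then have "g \<in> stab (U l)"
      using adapted_stab [OF basis_adapted _ basis_point] by blast
    with g show ?thesis by blast
  qed
  then show "y \<in> X closure_of ((\<lambda>g. a g x) ` stab (U l))"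
    using y basis_subset by (auto simp: in_closure_of)
qed

lemma fixed_on_closure:
  assumes h: "h \<in> carrier A" and y: "y \<in> X closure_of S" and fixed: "\<And>z. z \<in> S \<Longrightarrow> a h z = z"
  shows "a h y = y"
proof (rule forall_in_closure_of_eq [OF y hausdorff])
  show "continuous_map X X (a h)"
    using homeo [OF h] homeomorphic_imp_continuous_map by blast
qed (use fixed in auto)

lemma commutator_fixes:
  assumes h: "h \<in> carrier A" "a h x = x" and g: "g \<in> carrier A"
  shows "a (group_commutator A h (inv g)) x = x \<longleftrightarrow> a h (a g x) = a g x"
proof -
  define y where "y = a g x"
  have y: "y \<in> topspace X" using g base_in_space act_closed y_def by blast
  have hx: "a (inv h) x = x" using h act_inv1 base_in_space by metis
  have "a (group_commutator A h (inv g)) x = a h (a (inv g) (a (inv h) y))"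
    using h g base_in_space by (simp add: group_commutator_def act_mult act_closed y_def)
  also have "\<dots> = x \<longleftrightarrow> a (inv g) (a (inv h) y) = x"
    using h g y base_in_space act_closed act_inj hx by (metis inv_closed)
  also have "\<dots> \<longleftrightarrow> a (inv h) y = y"
    using h g y base_in_space act_closed act_inv1 act_inv2 y_def by (metis inv_closed)
  also have "\<dots> \<longleftrightarrow> a h y = y"
    using h y act_inv1 act_inv2 by metis
  finally show ?thesis by (simp add: y_def)
qed

text \<open>
  The commutator condition says that \<open>h\<close> fixes the \<open>stab (U l)\<close>-orbit of \<open>x\<close>, which is dense in
  \<open>U l\<close>.
\<close>

lemma stab_level_eq_fixator: "K l = fixator (U l)"
proof -
  have sub: "subgroup (stab (U l)) A" using stab_subgroup basis_subset by blast
  have "h \<in> K l \<longleftrightarrow> h \<in> fixator (U l)" for h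
  proof
    assume h: "h \<in> K l"
    then have hA: "h \<in> carrier A" "a h x = x" by (auto simp: stab_level_def stabilizer_def)
    have "a h (a g x) = a g x" if g: "g \<in> stab (U l)" for g
    proof -
      have "a (group_commutator A h (inv g)) x = x"
        using h subgroup.m_inv_closed [OF sub g] by (auto simp: stab_level_def stabilizer_def)
      then show ?thesis
        using commutator_fixes hA g by (auto simp: set_stabilizer_def)
    qed
    then have "a h y = y" if "y \<in> U l" for y
      using fixed_on_closure [OF hA(1)] stab_orbit_dense that by blast
    then show "h \<in> fixator (U l)" using hA by (simp add: fixator_def)
  next
    assume h: "h \<in> fixator (U l)"
    then have hA: "h \<in> carrier A" "a h x = x" using basis_point by (auto simp: fixator_def)
    have "group_commutator A h g \<in> stabilizer A a x" if g: "g \<in> stab (U l)" for g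
    proof -
      have gA: "g \<in> carrier A" using g by (simp add: set_stabilizer_def)
      have "inv g \<in> stab (U l)" using subgroup.m_inv_closed [OF sub g] .
      then have "a (inv g) x \<in> U l" using basis_point by (auto simp: set_stabilizer_def)
      then have "a h (a (inv g) x) = a (inv g) x" using h by (simp add: fixator_def)
      then have "a (group_commutator A h g) x = x"
        using commutator_fixes [OF hA, of "inv g"] gA by simp
      then show ?thesis
        using hA gA by (simp add: stabilizer_def group_commutator_def)
    qed
    then show "h \<in> K l" using hA by (simp add: stab_level_def stabilizer_def)
  qed
  then show ?thesis by blast
qed

lemma chain_bounded_eq: "chain_bounded A C \<longleftrightarrow> (\<exists>k. \<forall>l\<ge>k. C l = C k)"
proof -
  have "(\<lambda>h. h) \<in> iso (A\<lparr>carrier := C l\<rparr>) (A\<lparr>carrier := C l'\<rparr>) \<longleftrightarrow> C l = C l'" for l l'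
    by (auto simp: iso_def hom_def bij_betw_def)
  then show ?thesis
    unfolding chain_bounded_def by (intro iff_exI) (metis order_refl order_trans)
qed

lemma K_bounded_iff: "chain_bounded A K \<longleftrightarrow> (\<exists>k. \<forall>l\<ge>k. fixator (U l) \<subseteq> fixator (U k))"
proof -
  have "fixator (U l) = fixator (U k) \<longleftrightarrow> fixator (U l) \<subseteq> fixator (U k)" if "k \<le> l" for k l
    using fixator_antimono [OF basis_antimono [OF that]] by blast
  then show ?thesis
    by (simp add: chain_bounded_eq stab_level_eq_fixator)
qed

text \<open>
  Once the chain is stationary from \<open>k\<close> on, an element that is the identity on a nonempty open part
  of a translate of \<open>U k\<close> is the identity on the whole translate.
\<close>

lemma fixator_spread:
  assumes k: "\<forall>l\<ge>k. fixator (U l) \<subseteq> fixator (U k)"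
    and "g \<in> carrier A" "openin X V" "V \<noteq> {}" "V \<subseteq> a g ` U k"
  shows "fixator V \<subseteq> fixator (a g ` U k)"
proof
  fix h assume h: "h \<in> fixator V"
  obtain f m where f: "f \<in> carrier A" "a f x \<in> V" "\<And>l. l \<ge> m \<Longrightarrow> a f ` U l \<subseteq> V"
    using translate_into_open assms by metis
  define l where "l = max m k"
  have "h \<in> fixator (a f ` U l)" using fixator_antimono [OF f(3) [of l]] h by (auto simp: l_def)
  then have "inv f \<otimes> h \<otimes> f \<in> fixator (U k)"
    using fixator_translate_back [OF _ f(1) basis_subset] k unfolding l_def
    by (meson max.cobounded2 subsetD)
  then have "f \<otimes> (inv f \<otimes> h \<otimes> f) \<otimes> inv f \<in> fixator (a f ` U k)"
    using fixator_translate f basis_subset by blast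
  moreover have "f \<otimes> (inv f \<otimes> h \<otimes> f) \<otimes> inv f = h"
    using f h by (simp add: fixator_def m_assoc) (simp flip: m_assoc)
  \<comment> \<open>Both translates contain \<open>a f x\<close>, and translates of an adapted set are equal or disjoint.\<close>
  moreover have "a f ` U k = a g ` U k"
  proof -
    obtain u where u: "u \<in> U k" "a f x = a g u" using f(2) assms by blast
    then have uX: "u \<in> topspace X" using basis_subset by blast
    have "a (inv g \<otimes> f) x = u"
      using u uX assms(2) f(1) base_in_space by (simp add: act_mult act_inv1)
    then have "inv g \<otimes> f \<in> stab (U k)"
      using adapted_stab [OF basis_adapted _ basis_point, of "inv g \<otimes> f" k] u f(1) assms(2) by simp
    then have "a g ` a (inv g \<otimes> f) ` U k = a g ` U k" by (simp add: set_stabilizer_def)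
    then show ?thesis
      using f(1) assms(2) basis_subset by (simp add: image_mult image_inv2 image_subset)
  qed
  ultimately show "h \<in> fixator (a g ` U k)" by simp
qed

lemma K_bounded_iff_bounded_fixators: "chain_bounded A K \<longleftrightarrow> bounded_fixators"
proof
  assume "chain_bounded A K"
  then obtain k where k: "\<forall>l\<ge>k. fixator (U l) \<subseteq> fixator (U k)" by (auto simp: K_bounded_iff)
  have "fixator V \<subseteq> fixator (U k)" if "openin X V" "V \<noteq> {}" "V \<subseteq> U k" for V
    using fixator_spread [OF k one_closed, of V] that basis_subset by (simp add: image_one)
  then show bounded_fixators
    unfolding bounded_fixators_def using basis_open basis_nonempty by (intro exI [of _ "U k"]) simp
next
  assume bounded_fixators
  then obtain W where W: "openin X W" "W \<noteq> {}"
    "\<forall>V. openin X V \<and> V \<noteq> {} \<and> V \<subseteq> W \<longrightarrow> fixator V \<subseteq> fixator W"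
    unfolding bounded_fixators_def by blast
  obtain g k where g: "g \<in> carrier A" "\<And>l. l \<ge> k \<Longrightarrow> a g ` U l \<subseteq> W"
    using translate_into_open W by metis
  have "h \<in> fixator (U k)" if l: "l \<ge> k" and h: "h \<in> fixator (U l)" for l h
  proof -
    have "g \<otimes> h \<otimes> inv g \<in> fixator (a g ` U l)"
      using fixator_translate h g basis_subset by blast
    also have "\<dots> \<subseteq> fixator W"
      using W(3) g l basis_open basis_nonempty open_image by (metis image_is_empty)
    also have "\<dots> \<subseteq> fixator (a g ` U k)"
      using g(2) by (intro fixator_antimono) auto
    finally have "inv g \<otimes> (g \<otimes> h \<otimes> inv g) \<otimes> g \<in> fixator (U k)"
      using fixator_translate_back g basis_subset by blast
    moreover have "inv g \<otimes> (g \<otimes> h \<otimes> inv g) \<otimes> g = h"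
      using g h by (simp add: fixator_def m_assoc) (simp flip: m_assoc)
    ultimately show ?thesis by simp
  qed
  then show "chain_bounded A K" unfolding K_bounded_iff by blast
qed

lemma K_finite_iff_finite_fixators: "(\<forall>l. finite (K l)) \<longleftrightarrow> finite_fixators"
proof
  assume fin: "\<forall>l. finite (K l)"
  have "finite (fixator V)" if V: "openin X V" "V \<noteq> {}" for V
  proof -
    obtain g l where g: "g \<in> carrier A" "\<And>m. m \<ge> l \<Longrightarrow> a g ` U m \<subseteq> V"
      using translate_into_open V by metis
    have "fixator V \<subseteq> (\<lambda>h. g \<otimes> h \<otimes> inv g) ` fixator (U l)"
    proof
      fix h assume h: "h \<in> fixator V"
      then have "h \<in> fixator (a g ` U l)" using fixator_antimono g by blast
      then have "inv g \<otimes> h \<otimes> g \<in> fixator (U l)"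
        using fixator_translate_back g basis_subset by blast
      moreover have "h = g \<otimes> (inv g \<otimes> h \<otimes> g) \<otimes> inv g"
        using g h by (simp add: fixator_def m_assoc) (simp flip: m_assoc)
      ultimately show "h \<in> (\<lambda>h. g \<otimes> h \<otimes> inv g) ` fixator (U l)" by blast
    qed
    then show ?thesis
      using fin finite_surj unfolding stab_level_eq_fixator by blast
  qed
  then show finite_fixators by (simp add: finite_fixators_def)
next
  assume finite_fixators
  then show "\<forall>l. finite (K l)"
    using basis_open basis_nonempty by (simp add: finite_fixators_def stab_level_eq_fixator)
qed

lemma commutator_trivial:
  assumes "h \<in> carrier A" "g \<in> carrier A"
  shows "group_commutator A h g = \<one> \<longleftrightarrow> h \<otimes> g = g \<otimes> h"
proof -
  have "group_commutator A h g = (h \<otimes> g) \<otimes> inv (g \<otimes> h)"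
    using assms by (simp add: group_commutator_def inv_mult_group m_assoc)
  moreover have "(h \<otimes> g) \<otimes> inv (g \<otimes> h) \<otimes> (g \<otimes> h) = h \<otimes> g"
    using assms by (simp add: m_assoc del: inv_mult_group)
  ultimately show ?thesis
    using assms by (metis l_one m_closed r_inv)
qed

lemma Z_iff: "h \<in> Z l \<longleftrightarrow> h \<in> carrier A \<and> a h x = x \<and> (\<forall>g\<in>stab (U l). h \<otimes> g = g \<otimes> h)"
proof -
  have "stab (U l) \<subseteq> carrier A" by (auto simp: set_stabilizer_def)
  then show ?thesis
    using commutator_trivial by (auto simp: cent_level_def stabilizer_def subset_iff)
qed

lemma Z_subset_K: "Z l \<subseteq> K l"
proof -
  have "a \<one> x = x" using act_one base_in_space .
  then show ?thesis
    by (auto simp: cent_level_def stab_level_def stabilizer_def)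
qed

lemma commute_translate:
  assumes "g \<in> carrier A" "h \<in> carrier A" "V \<subseteq> topspace X"
    and com: "\<forall>k\<in>stab V. (inv g \<otimes> h \<otimes> g) \<otimes> k = k \<otimes> (inv g \<otimes> h \<otimes> g)"
    and k: "k \<in> stab (a g ` V)"
  shows "h \<otimes> k = k \<otimes> h"
proof -
  have kA: "k \<in> carrier A" using k by (simp add: set_stabilizer_def)
  have "inv g \<otimes> k \<otimes> g \<in> stab V" using stab_conj assms by blast
  then have "(inv g \<otimes> h \<otimes> g) \<otimes> (inv g \<otimes> k \<otimes> g) = (inv g \<otimes> k \<otimes> g) \<otimes> (inv g \<otimes> h \<otimes> g)"
    using com by blast
  moreover have "(inv g \<otimes> h \<otimes> g) \<otimes> (inv g \<otimes> k \<otimes> g) = inv g \<otimes> (h \<otimes> k) \<otimes> g"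
    if "h \<in> carrier A" "k \<in> carrier A" for h k
  proof -
    have "g \<otimes> (inv g \<otimes> (k \<otimes> g)) = k \<otimes> g"
      using that assms(1) by (simp flip: m_assoc)
    then show ?thesis using that assms(1) by (simp add: m_assoc)
  qed
  ultimately have "inv g \<otimes> (h \<otimes> k) \<otimes> g = inv g \<otimes> (k \<otimes> h) \<otimes> g"
    using assms kA by simp
  then show ?thesis
    using assms kA by simp
qed

text \<open>
  From left to right an element is conjugated into \<open>K l\<close> and back.  Conversely, flatness makes
  \<open>h \<in> K l\<close> commute with the stabilizer of an adapted set \<open>B\<close> that need not contain \<open>x\<close>.  The closure of
  the \<open>stab B\<close>-orbit of \<open>x\<close> is a neighbourhood of \<open>x\<close>; applying flatness a second time inside it gives
  an adapted set \<open>B'\<close> that some \<open>n\<close> in \<open>stab B\<close> carries \<open>x\<close> into.  As \<open>h\<close> commutes with \<open>n\<close> and with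
  \<open>stab B'\<close>, it commutes with the stabilizer of the translate of \<open>B'\<close> by the inverse of \<open>n\<close>, which
  contains \<open>x\<close>.
\<close>

lemma flat_iff_flat_fixators: "(\<Union>l. Z l) = (\<Union>l. K l) \<longleftrightarrow> flat_fixators"
proof
  assume eq: "(\<Union>l. Z l) = (\<Union>l. K l)"
  show flat_fixators
    unfolding flat_fixators_def
  proof (intro allI impI, elim conjE)
    fix V h assume V: "openin X V" "V \<noteq> {}" and h: "h \<in> fixator V"
    have hA: "h \<in> carrier A" using h by (simp add: fixator_def)
    obtain g l where g: "g \<in> carrier A" "\<And>m. m \<ge> l \<Longrightarrow> a g ` U m \<subseteq> V"
      using translate_into_open V by metis
    define h' where "h' = inv g \<otimes> h \<otimes> g"
    have "h \<in> fixator (a g ` U l)" using fixator_antimono g h by blast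
    then have "h' \<in> K l"
      using fixator_translate_back g basis_subset unfolding stab_level_eq_fixator h'_def by blast
    then obtain m where "h' \<in> Z m" using eq by blast
    then have com: "\<forall>k\<in>stab (U m). h' \<otimes> k = k \<otimes> h'" by (simp add: Z_iff)
    \<comment> \<open>\<open>l\<close> keeps the translate inside \<open>V\<close>, and \<open>m\<close> makes the conjugate of \<open>h\<close> commute.\<close>
    define p where "p = max l m"
    have "\<forall>k\<in>stab (U p). h' \<otimes> k = k \<otimes> h'"
      using com stab_mono [OF basis_adapted basis_adapted basis_antimono, of m p]
      by (auto simp: p_def)
    then have "\<forall>k\<in>stab (a g ` U p). h \<otimes> k = k \<otimes> h"
      using commute_translate [OF g(1) hA basis_subset] unfolding h'_def by simp
    moreover have "adapted (a g ` U p)" using adapted_translate basis_adapted g by blast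
    moreover have "a g ` U p \<subseteq> V" using g by (simp add: p_def)
    ultimately show "\<exists>B\<subseteq>V. adapted B \<and> (\<forall>g\<in>stab B. h \<otimes> g = g \<otimes> h)" by blast
  qed
next
  assume flat: flat_fixators
  have "h \<in> (\<Union>l. Z l)" if h: "h \<in> K l" for h l
  proof -
    have hfix: "h \<in> fixator (U l)" using h stab_level_eq_fixator by simp
    then have hA: "h \<in> carrier A" "a h x = x" using basis_point by (auto simp: fixator_def)
    obtain B where B: "adapted B" "\<forall>g\<in>stab B. h \<otimes> g = g \<otimes> h"
      using flat hfix basis_open basis_nonempty unfolding flat_fixators_def by metis
    obtain W where W: "openin X W" "x \<in> W" "W \<subseteq> X closure_of ((\<lambda>g. a g x) ` stab B)"
      using stab_orbit_closure_nbhd B base_in_space by metis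
    obtain B' where B': "B' \<subseteq> W \<inter> U l" "adapted B'" "\<forall>g\<in>stab B'. h \<otimes> g = g \<otimes> h"
    proof -
      have "h \<in> fixator (W \<inter> U l)" using hfix fixator_antimono by blast
      moreover have "openin X (W \<inter> U l)" "W \<inter> U l \<noteq> {}"
        using W basis_open basis_point by auto
      ultimately show thesis
        using flat that unfolding flat_fixators_def by blast
    qed
    have B'open: "openin X B'" "B' \<noteq> {}" using B' by (auto simp: adapted_set_def)
    obtain v where v: "v \<in> B'" using B'open by blast
    then have "v \<in> X closure_of ((\<lambda>g. a g x) ` stab B)" using B' W by blast
    then obtain n where n: "n \<in> stab B" "a n x \<in> B'"
      using v B'open unfolding in_closure_of by blast
    have nA: "n \<in> carrier A" using n by (simp add: set_stabilizer_def)
    have "x \<in> a (inv n) ` B'"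
      using n nA base_in_space act_inv1 by (metis image_eqI)
    then obtain m where m: "U m \<subseteq> a (inv n) ` B'"
      using basis_shrinks open_image B'open nA by (metis inv_closed)
    have "h \<otimes> g = g \<otimes> h" if g: "g \<in> stab (U m)" for g
    proof -
      have "g \<in> stab (a (inv n) ` B')"
        using stab_mono [OF basis_adapted adapted_translate [OF B'(2)] m] nA g by auto
      then have "h \<otimes> n = n \<otimes> h" "\<forall>k\<in>stab B'. h \<otimes> k = k \<otimes> h" 
        using B B' n by auto
      moreover have "inv (inv n) \<otimes> h \<otimes> inv n = h"
        using B(2) n hA nA by (simp add: inv_solve_right')
      ultimately show ?thesis
        using commute_translate [of "inv n" h B' g] nA hA adapted_subset [OF B'(2)]
          \<open>g \<in> stab (a (inv n) ` B')\<close> by simp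
    qed
    then have "h \<in> Z m" using hA by (simp add: Z_iff)
    then show ?thesis by blast
  qed
  then show "(\<Union>l. Z l) = (\<Union>l. K l)" using Z_subset_K by blast
qed

lemma finite_type_iff:
  "finite_type_chain A a x (\<lambda>l. stab (U l)) \<longleftrightarrow> \<not> bounded_fixators \<and> finite_fixators"
  by (simp add: finite_type_chain_def K_bounded_iff_bounded_fixators K_finite_iff_finite_fixators)

lemma flat_type_iff:
  "flat_type_chain A a x (\<lambda>l. stab (U l)) \<longleftrightarrow> \<not> bounded_fixators \<and> flat_fixators"
proof -
  have "(\<lambda>h. h) \<in> iso (chain_limit A Z) (chain_limit A K) \<longleftrightarrow> (\<Union>l. Z l) = (\<Union>l. K l)"
    by (auto simp: chain_limit_def iso_def hom_def bij_betw_def)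
  then show ?thesis
    by (simp add: flat_type_chain_def K_bounded_iff_bounded_fixators flat_iff_flat_fixators)
qed

lemma dynamical_type_iff:
  "dynamical_type_chain A a x (\<lambda>l. stab (U l)) \<longleftrightarrow> \<not> bounded_fixators \<and> \<not> flat_fixators"
  by (auto simp: dynamical_type_chain_def flat_type_iff K_bounded_iff_bounded_fixators)

end

section \<open>Local quasi-analyticity\<close>

context based_homeo_action
begin

lemma mdist_le_mdiameter:
  assumes "mtopology_of d = X" "S \<subseteq> topspace X" "y \<in> S" "z \<in> S"
  shows "mdist d y z \<le> mdiameter d S"
proof -
  interpret M: Metric_space "mspace d" "mdist d" by simp
  have X: "M.mtopology = X" using assms(1) by (simp add: mtopology_of_def)
  have "M.mbounded (mspace d)"
    using compact M.compactin_imp_mbounded X by (metis M.topspace_mtopology compact_space_def)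
  then obtain c where c: "\<And>y z. y \<in> mspace d \<Longrightarrow> z \<in> mspace d \<Longrightarrow> mdist d y z \<le> c"
    unfolding M.mbounded_alt by blast
  have S: "S \<subseteq> mspace d" using assms(2) X by auto
  have "bdd_above ((\<lambda>(y, z). mdist d y z) ` (S \<times> S))"
    using c S by (intro bdd_aboveI2 [where M = c]) auto
  then have "(\<lambda>(y, z). mdist d y z) (y, z) \<le> (SUP (y, z)\<in>S \<times> S. mdist d y z)"
    using assms by (intro cSUP_upper) auto
  then show ?thesis using assms by (auto simp: mdiameter_def)
qed

text \<open>
  The radius for LQA is a Lebesgue number of the partition into translates of \<open>U k\<close>.  In particular
  LQA does not depend on the metric chosen.
\<close>

lemma lqa_iff_bounded_fixators:
  assumes d: "mtopology_of d = X"
  shows "lqa d A a \<longleftrightarrow> bounded_fixators"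
proof -
  interpret M: Metric_space "mspace d" "mdist d" by simp
  have X: "M.mtopology = X" using d by (simp add: mtopology_of_def)
  have MX: "mspace d = topspace X" using X by auto
  show ?thesis
  proof
    assume "lqa d A a"
    then obtain e where e: "e > 0"
      and loc: "\<forall>B C. adapted B \<and> mdiameter d B < e \<and> adapted C \<and> C \<subseteq> B \<longrightarrow>
        (\<forall>g1\<in>carrier A. \<forall>g2\<in>carrier A. (\<forall>y\<in>C. a g1 y = a g2 y) \<longrightarrow> (\<forall>y\<in>B. a g1 y = a g2 y))"
      unfolding lqa_def d by blast
    \<comment> \<open>Radius \<open>e / 3\<close> bounds the diameter by \<open>2 * e / 3\<close>, strictly below \<open>e\<close>.\<close>
    obtain k where k: "U k \<subseteq> M.mball x (e / 3)"
      using basis_shrinks [of "M.mball x (e / 3)"] e base_in_space X MX M.openin_mball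
      by (metis M.centre_in_mball_iff zero_less_divide_iff zero_less_numeral)
    have "mdist d y z \<le> 2 * e / 3" if "y \<in> U k" "z \<in> U k" for y z
    proof -
      have "mdist d x y < e / 3" "mdist d x z < e / 3" "y \<in> mspace d" "z \<in> mspace d" "x \<in> mspace d"
        using that k by auto
      then show ?thesis
        using M.triangle [of y x z] M.commute [of x y] by simp
    qed
    then have "(SUP (y, z)\<in>U k \<times> U k. mdist d y z) \<le> 2 * e / 3"
      using basis_nonempty [of k] by (intro cSUP_least) auto
    then have "mdiameter d (U k) \<le> 2 * e / 3"
      using basis_nonempty [of k] by (simp add: mdiameter_def)
    then have dk: "mdiameter d (U k) < e" using e by simp
    have one: "a \<one> y = y" if "y \<in> U m" for m y
      using act_one basis_subset that by blast
    have "h \<in> fixator (U k)" if "l \<ge> k" "h \<in> fixator (U l)" for h l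
    proof -
      have "\<forall>y\<in>U l. a h y = a \<one> y" "h \<in> carrier A"
        using that(2) one by (auto simp: fixator_def)
      then have "\<forall>y\<in>U k. a h y = a \<one> y"
        using loc [rule_format, of "U k" "U l" h \<one>] dk basis_adapted basis_antimono [OF that(1)]
        by blast
      then show ?thesis
        using that(2) one by (auto simp: fixator_def)
    qed
    then show bounded_fixators
      unfolding K_bounded_iff_bounded_fixators [symmetric] K_bounded_iff by blast
  next
    assume bounded_fixators
    then obtain k where k: "\<forall>l\<ge>k. fixator (U l) \<subseteq> fixator (U k)"
      unfolding K_bounded_iff_bounded_fixators [symmetric] K_bounded_iff by blast
    obtain F where F: "F \<subseteq> carrier A" "topspace X = (\<Union>f\<in>F. a f ` U k)"
      using finite_translates_cover [OF basis_adapted] by metis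
    have "\<exists>e>0. \<forall>y\<in>topspace X. \<exists>W\<in>(\<lambda>f. a f ` U k) ` F. M.mball y e \<subseteq> W"
    proof (rule M.lebesgue_number)
      show "compactin M.mtopology (topspace X)"
        using compact X by (simp add: compact_space_def)
      show "openin M.mtopology W" if "W \<in> (\<lambda>f. a f ` U k) ` F" for W
        using that F open_image basis_open X by auto
    qed (use F in auto)
    then obtain e where e: "e > 0"
      and ball: "\<And>y. y \<in> topspace X \<Longrightarrow> \<exists>f\<in>F. M.mball y e \<subseteq> a f ` U k"
      by auto
    have "\<forall>y\<in>B. a g1 y = a g2 y"
      if B: "adapted B" "mdiameter d B < e" and C: "adapted C" "C \<subseteq> B"
        and g: "g1 \<in> carrier A" "g2 \<in> carrier A" and eq: "\<forall>y\<in>C. a g1 y = a g2 y" for B C g1 g2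
    proof -
      have BX: "B \<subseteq> topspace X" using B adapted_subset by blast
      obtain y where y: "y \<in> B" using B by (auto simp: adapted_set_def)
      then obtain f where f: "f \<in> F" "M.mball y e \<subseteq> a f ` U k" using ball BX by blast
      have "B \<subseteq> M.mball y e"
      proof
        fix z assume z: "z \<in> B"
        then have "mdist d y z < e" using mdist_le_mdiameter [OF d BX y z] B(2) by simp
        moreover have "y \<in> mspace d" "z \<in> mspace d" using y z BX MX by auto
        ultimately show "z \<in> M.mball y e" using M.in_mball by blast
      qed
      then have Bf: "B \<subseteq> a f ` U k" using f by blast
      have "inv g2 \<otimes> g1 \<in> fixator C"
        using fixator_diff g C eq adapted_subset by blast
      also have "fixator C \<subseteq> fixator (a f ` U k)"
      proof (rule fixator_spread [OF k])
        show "f \<in> carrier A" using F f by blast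
        show "openin X C" "C \<noteq> {}" using C by (auto simp: adapted_set_def)
        show "C \<subseteq> a f ` U k" using C Bf by blast
      qed
      also have "\<dots> \<subseteq> fixator B" using Bf by (rule fixator_antimono)
      finally show ?thesis using fixator_diff g BX by blast
    qed
    then show "lqa d A a" unfolding lqa_def d using e by blast
  qed
qed

section \<open>Non-Hausdorff elements and the germinal groupoid\<close>

lemma non_Hausdorff_imp_not_bounded:
  assumes h: "h \<in> carrier A" and y: "y \<in> topspace X" and nh: "non_Hausdorff_at A X a h y"
  shows "\<not> bounded_fixators"
proof
  assume bounded_fixators
  then obtain k where k: "\<forall>l\<ge>k. fixator (U l) \<subseteq> fixator (U k)"
    unfolding K_bounded_iff_bounded_fixators [symmetric] K_bounded_iff by blast
  obtain F where F: "F \<subseteq> carrier A" "topspace X = (\<Union>f\<in>F. a f ` U k)"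
    using finite_translates_cover [OF basis_adapted] by metis
  obtain f where f: "f \<in> carrier A" "y \<in> a f ` U k" using F y by blast
  have o: "openin X (a f ` U k)" using open_image f basis_open by blast
  then obtain S where S: "openin X S" "S \<noteq> {}" "S \<subseteq> a f ` U k" "\<forall>z\<in>S. a h z = z"
    using nh f unfolding non_Hausdorff_at_def by meson
  then have "h \<in> fixator S" using h by (simp add: fixator_def)
  then have "h \<in> fixator (a f ` U k)"
    using fixator_spread [OF k f(1) S(1-3)] by blast
  then show False
    using nh o f unfolding non_Hausdorff_at_def fixator_def by blast
qed

lemma non_Hausdorff_imp_not_flat:
  assumes h: "h \<in> carrier A" and y: "y \<in> topspace X" and nh: "non_Hausdorff_at A X a h y"
  shows "\<not> flat_fixators"
proof
  assume flat: flat_fixators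
  obtain S where S: "openin X S" "S \<noteq> {}" "\<forall>z\<in>S. a h z = z"
    using nh y unfolding non_Hausdorff_at_def by (meson openin_topspace)
  then have "h \<in> fixator S" using h by (simp add: fixator_def)
  then obtain B where B: "adapted B" "\<forall>g\<in>stab B. h \<otimes> g = g \<otimes> h"
    using flat S unfolding flat_fixators_def by blast
  obtain W where W: "openin X W" "y \<in> W" "W \<subseteq> X closure_of ((\<lambda>g. a g y) ` stab B)"
    using stab_orbit_closure_nbhd [OF B(1) y] by blast
  have hy: "a h y = y" using nh by (simp add: non_Hausdorff_at_def)
  have "a h z = z" if z: "z \<in> (\<lambda>g. a g y) ` stab B" for z
  proof -
    obtain n where n: "n \<in> stab B" "z = a n y" using z by blast
    then have nA: "n \<in> carrier A" by (simp add: set_stabilizer_def)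
    have "a h (a n y) = a (h \<otimes> n) y" using h nA y by (simp add: act_mult)
    also have "\<dots> = a (n \<otimes> h) y" using B n by simp
    also have "\<dots> = a n y" using h nA y hy by (simp add: act_mult)
    finally show ?thesis using n by simp
  qed
  then have "\<forall>z\<in>W. a h z = z"
    using fixed_on_closure [OF h] W by blast
  then show False
    using nh W unfolding non_Hausdorff_at_def by blast
qed

end

context homeo_action
begin

lemma mem_germ_iff:
  "(g', z) \<in> germ A X a g y \<longleftrightarrow> g \<in> carrier A \<and> g' \<in> carrier A \<and> y \<in> topspace X \<and> z = y \<and>
     (\<exists>V. openin X V \<and> y \<in> V \<and> (\<forall>w\<in>V. a g w = a g' w))"
  by (auto simp: germ_def germ_rel_def)

lemma germ_self: "g \<in> carrier A \<Longrightarrow> y \<in> topspace X \<Longrightarrow> (g, y) \<in> germ A X a g y"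
  unfolding mem_germ_iff by auto

lemma germ_eqI:
  assumes "g \<in> carrier A" "g' \<in> carrier A" and V: "openin X V" "y \<in> V" "\<forall>w\<in>V. a g w = a g' w"
  shows "germ A X a g y = germ A X a g' y"
proof -
  have y: "y \<in> topspace X" using V openin_subset by blast
  have "p \<in> germ A X a g y \<longleftrightarrow> p \<in> germ A X a g' y" for p
  proof (cases p)
    case (Pair k z)
    have "(\<exists>W. openin X W \<and> y \<in> W \<and> (\<forall>w\<in>W. a g w = a k w)) \<longleftrightarrow>
          (\<exists>W. openin X W \<and> y \<in> W \<and> (\<forall>w\<in>W. a g' w = a k w))" (is "(\<exists>W. ?P W) \<longleftrightarrow> (\<exists>W. ?Q W)")
    proof
      assume "\<exists>W. ?P W"
      then obtain W where "?P W" ..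
      then have "?Q (W \<inter> V)" using V by auto
      then show "\<exists>W. ?Q W" ..
    next
      assume "\<exists>W. ?Q W"
      then obtain W where "?Q W" ..
      then have "?P (W \<inter> V)" using V by auto
      then show "\<exists>W. ?P W" ..
    qed
    then show ?thesis using Pair assms by (simp add: mem_germ_iff)
  qed
  then show ?thesis by blast
qed

text \<open>
  The only germs that are not separated by the topology of the space are germs at one point \<open>y\<close> of
  elements \<open>g\<close>, \<open>k\<close> with the same value at \<open>y\<close>.  If \<open>inv k \<otimes> g\<close> is not non-Hausdorff at \<open>y\<close>, then \<open>g\<close> and
  \<open>k\<close> agree near \<open>y\<close>, or they agree on no nonempty open subset of some neighbourhood of \<open>y\<close>.
\<close>

lemma Hausdorff_germinal_groupoid:
  assumes haus: "Hausdorff_space X" and no: "\<not> (\<exists>g. non_Hausdorff_element A X a g)"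
  shows "Hausdorff_space (germinal_groupoid_topology A X a)"
proof -
  have basic: "openin (germinal_groupoid_topology A X a) (germ A X a g ` V)"
    if "g \<in> carrier A" "openin X V" for g V
    unfolding germinal_groupoid_topology_def
    by (rule topology_generated_by_Basis) (use that in blast)
  have germ_agree: "y = z \<and> (\<exists>W. openin X W \<and> y \<in> W \<and> (\<forall>w\<in>W. a g w = a k w))"
    if "germ A X a g y = germ A X a k z" "g \<in> carrier A" "k \<in> carrier A"
       "y \<in> topspace X" "z \<in> topspace X" for g k y z
    using germ_self [OF that(3,5)] unfolding that(1) [symmetric] mem_germ_iff by blast
  have separate: "\<exists>P Q. openin (germinal_groupoid_topology A X a) P \<and>
      openin (germinal_groupoid_topology A X a) Q \<and>
      germ A X a g y \<in> P \<and> germ A X a k z \<in> Q \<and> disjnt P Q"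
    if g: "g \<in> carrier A" and k: "k \<in> carrier A" and y: "y \<in> topspace X" and z: "z \<in> topspace X"
      and ne: "germ A X a g y \<noteq> germ A X a k z" for g k y z
  proof -
    have "\<exists>V W. openin X V \<and> openin X W \<and> y \<in> V \<and> z \<in> W \<and>
      disjnt (germ A X a g ` V) (germ A X a k ` W)"
    proof (cases "y = z")
      case False
      then obtain V W where VW: "openin X V" "openin X W" "y \<in> V" "z \<in> W" "disjnt V W"
        using haus y z unfolding Hausdorff_space_def by metis
      then have sub: "V \<subseteq> topspace X" "W \<subseteq> topspace X" using openin_subset by auto
      have "disjnt (germ A X a g ` V) (germ A X a k ` W)"
        unfolding disjnt_iff
      proof clarify
        fix v w assume vw: "v \<in> V" "w \<in> W" "germ A X a g v = germ A X a k w"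
        then have "v = w" using germ_agree g k sub by blast
        then show False using vw VW by (auto simp: disjnt_iff)
      qed
      then show ?thesis using VW by blast
    next
      case True
      have "\<exists>V. openin X V \<and> y \<in> V \<and>
        (\<forall>S. openin X S \<and> S \<noteq> {} \<and> S \<subseteq> V \<longrightarrow> \<not> (\<forall>w\<in>S. a g w = a k w))"
      proof (cases "a g y = a k y")
        case False
        have "a g y \<in> topspace X" "a k y \<in> topspace X" using act_closed g k y by auto
        then obtain P Q where PQ: "openin X P" "openin X Q" "a g y \<in> P" "a k y \<in> Q" "disjnt P Q"
          using haus False unfolding Hausdorff_space_def by metis
        define V where "V = {w \<in> topspace X. a g w \<in> P} \<inter> {w \<in> topspace X. a k w \<in> Q}"
        have "openin X V"
          unfolding V_def using homeo g k PQ homeomorphic_imp_continuous_map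
          by (intro openin_Int openin_continuous_map_preimage) auto
        moreover have "y \<in> V" using y PQ by (simp add: V_def)
        moreover have "\<forall>w\<in>V. a g w \<noteq> a k w" using PQ(5) by (auto simp: V_def disjnt_iff)
        ultimately show ?thesis by blast
      next
        case eq: True
        define h where "h = inv k \<otimes> g"
        have hA: "h \<in> carrier A" using g k by (simp add: h_def)
        have h_fix: "a h w = w \<longleftrightarrow> a g w = a k w" if "w \<in> topspace X" for w
          using fixator_diff [OF g k, of "{w}"] that hA by (simp add: fixator_def h_def)
        have "\<not> non_Hausdorff_at A X a h y"
          using no hA y by (auto simp: non_Hausdorff_element_def)
        moreover have "a h y = y" using h_fix y eq by simp
        moreover have "\<not> (\<exists>V. openin X V \<and> y \<in> V \<and> (\<forall>w\<in>V. a h w = w))"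
        proof
          assume "\<exists>V. openin X V \<and> y \<in> V \<and> (\<forall>w\<in>V. a h w = w)"
          then obtain V where V: "openin X V" "y \<in> V" "\<forall>w\<in>V. a h w = w" by blast
          then have "\<forall>w\<in>V. a g w = a k w" using h_fix openin_subset by blast
          then show False using germ_eqI [OF g k V(1,2)] ne True by simp
        qed
        ultimately obtain V where V: "openin X V" "y \<in> V"
          and S: "\<And>S. openin X S \<Longrightarrow> S \<noteq> {} \<Longrightarrow> S \<subseteq> V \<Longrightarrow> \<not> (\<forall>w\<in>S. a h w = w)"
          unfolding non_Hausdorff_at_def by metis
        have "\<not> (\<forall>w\<in>S. a g w = a k w)" if "openin X S" "S \<noteq> {}" "S \<subseteq> V" for S
          using S [OF that] h_fix openin_subset [OF that(1)] by blast
        with V show ?thesis by blast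
      qed
      then obtain V where V: "openin X V" "y \<in> V"
        and dis: "\<And>S. openin X S \<Longrightarrow> S \<noteq> {} \<Longrightarrow> S \<subseteq> V \<Longrightarrow> \<not> (\<forall>w\<in>S. a g w = a k w)"
        by metis
      have "disjnt (germ A X a g ` V) (germ A X a k ` V)"
        unfolding disjnt_iff
      proof clarify
        fix v w assume vw: "v \<in> V" "w \<in> V" "germ A X a g v = germ A X a k w"
        have "v \<in> topspace X" "w \<in> topspace X" using vw V openin_subset by blast+
        then obtain S where S: "openin X S" "v \<in> S" "\<forall>w\<in>S. a g w = a k w"
          using germ_agree [OF vw(3) g k] by blast
        then show False using dis [of "S \<inter> V"] V(1) vw(1) by auto
      qed
      then show ?thesis using V True by blast
    qed
    then obtain V W where VW: "openin X V" "openin X W" "y \<in> V" "z \<in> W"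
      "disjnt (germ A X a g ` V) (germ A X a k ` W)" by blast
    then show ?thesis
      using basic [OF g VW(1)] basic [OF k VW(2)] by blast
  qed
  have germs: "\<exists>g y. g \<in> carrier A \<and> y \<in> topspace X \<and> p = germ A X a g y"
    if "p \<in> topspace (germinal_groupoid_topology A X a)" for p
  proof -
    obtain g V where "g \<in> carrier A" "openin X V" "p \<in> germ A X a g ` V"
      using \<open>p \<in> _\<close> unfolding germinal_groupoid_topology_def by auto
    then show ?thesis using openin_subset by blast
  qed
  show ?thesis
    unfolding Hausdorff_space_def
  proof (intro allI impI, elim conjE)
    fix p q assume pq: "p \<in> topspace (germinal_groupoid_topology A X a)"
      "q \<in> topspace (germinal_groupoid_topology A X a)" "p \<noteq> q"
    obtain g y where p: "g \<in> carrier A" "y \<in> topspace X" "p = germ A X a g y"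
      using germs [OF pq(1)] by blast
    obtain k z where q: "k \<in> carrier A" "z \<in> topspace X" "q = germ A X a k z"
      using germs [OF pq(2)] by blast
    show "\<exists>P Q. openin (germinal_groupoid_topology A X a) P \<and>
        openin (germinal_groupoid_topology A X a) Q \<and> p \<in> P \<and> q \<in> Q \<and> disjnt P Q"
      using separate [OF p(1) q(1) p(2) q(2)] pq(3) unfolding p(3) q(3) by blast
  qed
qed

end

section \<open>The homeomorphism group\<close>

lemma carrier_homeo_group:
  "f \<in> carrier (homeo_group X) \<longleftrightarrow> f \<in> Bij (topspace X) \<and> homeomorphic_map X X f"
  by (simp add: homeo_group_def)

lemma group_homeo_group: "group (homeo_group X)"
proof -
  interpret B: group "BijGroup (topspace X)" by (rule group_BijGroup)
  have "subgroup {f \<in> Bij (topspace X). homeomorphic_map X X f} (BijGroup (topspace X))"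
  proof (rule B.subgroupI)
    have "(\<lambda>y\<in>topspace X. y) \<in> {f \<in> Bij (topspace X). homeomorphic_map X X f}"
      using homeomorphic_map_eq [of X X id "\<lambda>y\<in>topspace X. y"] id_Bij by auto
    then show "{f \<in> Bij (topspace X). homeomorphic_map X X f} \<noteq> {}" by blast
  next
    fix f g assume f: "f \<in> {f \<in> Bij (topspace X). homeomorphic_map X X f}"
      and g: "g \<in> {f \<in> Bij (topspace X). homeomorphic_map X X f}"
    have "homeomorphic_map X X (compose (topspace X) f g)"
      by (rule homeomorphic_map_eq [OF homeomorphic_map_compose [of X X g X f]])
        (use f g in \<open>auto simp: compose_def\<close>)
    then show "f \<otimes>\<^bsub>BijGroup (topspace X)\<^esub> g \<in> {f \<in> Bij (topspace X). homeomorphic_map X X f}"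
      using f g compose_Bij by (auto simp: BijGroup_def)
  next
    fix f assume f: "f \<in> {f \<in> Bij (topspace X). homeomorphic_map X X f}"
    then have i: "inv\<^bsub>BijGroup (topspace X)\<^esub> f = (\<lambda>y\<in>topspace X. inv_into (topspace X) f y)"
      by (auto intro: inv_BijGroup)
    obtain f' where f': "homeomorphic_maps X X f f'"
      using f homeomorphic_map_maps by blast
    have "homeomorphic_map X X (\<lambda>y\<in>topspace X. inv_into (topspace X) f y)"
    proof (rule homeomorphic_map_eq)
      show "homeomorphic_map X X f'" using f' homeomorphic_maps_map by blast
      fix y assume y: "y \<in> topspace X"
      have f'y: "f' y \<in> topspace X" "f (f' y) = y"
        using f' y unfolding homeomorphic_maps_def continuous_map_def by auto
      then show "f' y = (\<lambda>y\<in>topspace X. inv_into (topspace X) f y) y"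
        using y f inv_into_f_f [of f "topspace X" "f' y"] by (auto simp: Bij_def bij_betw_def)
    qed
    then show "inv\<^bsub>BijGroup (topspace X)\<^esub> f \<in> {f \<in> Bij (topspace X). homeomorphic_map X X f}"
      using f restrict_inv_into_Bij i by auto
  qed (auto simp: BijGroup_def)
  then show ?thesis
    unfolding homeo_group_def by (rule subgroup.subgroup_is_group) (rule B.group_axioms)
qed

lemma homeo_action_homeo_group: "homeo_action (homeo_group X) X (\<lambda>f. f)"
proof -
  interpret group "homeo_group X" by (rule group_homeo_group)
  show ?thesis
    by unfold_locales (auto simp: top_action_def hom_def group_homeo_group)
qed

lemma top_action_subgroup:
  assumes "subgroup H (homeo_group X)"
  shows "top_action ((homeo_group X)\<lparr>carrier := H\<rparr>) X (\<lambda>f. f)"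
  using subgroup.subgroup_is_group [OF assms group_homeo_group] subgroup.subset [OF assms]
  by (auto simp: top_action_def hom_def)

section \<open>The profinite closure\<close>

text \<open>
  An action on a compact metric space; its profinite closure \<open>P\<close> acts by evaluation.
\<close>

locale metric_homeo_action = homeo_action +
  fixes d :: "'c metric"
  assumes compact_space: "compact_space X" and metric: "mtopology_of d = X"
begin

abbreviation P where "P \<equiv> profinite_closure d A a"

lemma mspace_eq: "mspace d = topspace X"
  using metric by (metis topspace_mtopology_of)

lemma carrier_homeo_in_cfunspace: "carrier (homeo_group X) \<subseteq> mspace (cfunspace X d)"
proof
  fix f assume f: "f \<in> carrier (homeo_group X)"
  then have "continuous_map X X f" "f \<in> extensional (topspace X)"
    by (auto simp: carrier_homeo_group homeomorphic_imp_continuous_map Bij_def)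
  moreover have "compactin X (topspace X)" using compact_space by (simp add: compact_space_def)
  ultimately show "f \<in> mspace (cfunspace X d)"
    unfolding compactin_mspace_cfunspace [OF \<open>compactin X (topspace X)\<close>] metric
    using mspace_eq by (auto simp: continuous_map_def)
qed

text \<open>
  Closure in the topology of uniform convergence, spelled out with the metric of the space.
\<close>

lemma in_uniform_closure_iff:
  assumes S: "S \<subseteq> carrier (homeo_group X)"
  shows "f \<in> uniform_topology d closure_of S \<longleftrightarrow> f \<in> carrier (homeo_group X) \<and>
    (\<forall>e>0. \<exists>g\<in>S. \<forall>y\<in>topspace X. mdist d (f y) (g y) < e)"
proof -
  interpret F: Metric_space "mspace (cfunspace X d)" "mdist (cfunspace X d)"
    by (rule Metric_space_mspace_mdist)
  note mspace_cfunspace [simp del]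
  have cpt: "compactin X (topspace X)" using compact_space by (simp add: compact_space_def)
  have top: "uniform_topology d = subtopology F.mtopology (carrier (homeo_group X))"
    unfolding uniform_topology_def metric by (simp only: mtopology_of_def)
  have "(\<forall>r>0. \<exists>g\<in>S. g \<in> F.mball f r) \<longleftrightarrow> (\<forall>e>0. \<exists>g\<in>S. \<forall>y\<in>topspace X. mdist d (f y) (g y) < e)"
    if f: "f \<in> carrier (homeo_group X)"
  proof
    assume L: "\<forall>r>0. \<exists>g\<in>S. g \<in> F.mball f r"
    show "\<forall>e>0. \<exists>g\<in>S. \<forall>y\<in>topspace X. mdist d (f y) (g y) < e"
    proof (intro allI impI)
      fix e :: real assume "e > 0"
      then obtain g where g: "g \<in> S" "g \<in> F.mball f e" using L by blast
      then have "\<forall>y\<in>topspace X. mdist d (f y) (g y) < e"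
        using cfunspace_mdist_lt [OF cpt, of f d g e] unfolding F.in_mball by blast
      with g show "\<exists>g\<in>S. \<forall>y\<in>topspace X. mdist d (f y) (g y) < e" by blast
    qed
  next
    assume R: "\<forall>e>0. \<exists>g\<in>S. \<forall>y\<in>topspace X. mdist d (f y) (g y) < e"
    show "\<forall>r>0. \<exists>g\<in>S. g \<in> F.mball f r"
    proof (intro allI impI)
      fix r :: real assume r: "r > 0"
      then obtain g where g: "g \<in> S" "\<forall>y\<in>topspace X. mdist d (f y) (g y) < r / 2"
        using R by (meson half_gt_zero)
      then have "mdist (cfunspace X d) f g \<le> r / 2"
        using r by (intro mdist_cfunspace_le) (auto intro: less_imp_le)
      then have "g \<in> F.mball f r"
        using f g(1) r S carrier_homeo_in_cfunspace unfolding F.in_mball by (auto simp: subset_iff)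
      with g show "\<exists>g\<in>S. g \<in> F.mball f r" by blast
    qed
  qed
  moreover have "f \<in> uniform_topology d closure_of S \<longleftrightarrow>
      f \<in> carrier (homeo_group X) \<and> (\<forall>r>0. \<exists>g\<in>S. g \<in> F.mball f r)"
    using S carrier_homeo_in_cfunspace
    unfolding top closure_of_subtopology F.metric_closure_of by (auto simp: Int_absorb1 subset_iff)
  ultimately show ?thesis by blast
qed

lemma image_in_homeo_group: "a ` carrier A \<subseteq> carrier (homeo_group X)"
  using homeo Bij by (auto simp: carrier_homeo_group)

lemma in_P_iff: "f \<in> carrier P \<longleftrightarrow> f \<in> carrier (homeo_group X) \<and>
    (\<forall>e>0. \<exists>g\<in>carrier A. \<forall>y\<in>topspace X. mdist d (f y) (a g y) < e)"
  by (simp add: profinite_closure_def in_uniform_closure_iff [OF image_in_homeo_group])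

lemma image_in_P: "g \<in> carrier A \<Longrightarrow> a g \<in> carrier P"
  unfolding in_P_iff
proof (intro conjI allI impI)
  interpret M: Metric_space "mspace d" "mdist d" by simp
  fix e :: real assume g: "g \<in> carrier A" and e: "e > 0"
  have "mdist d (a g y) (a g y) < e" if "y \<in> topspace X" for y
    using M.mdist_zero [of "a g y"] act_closed [OF g that] e unfolding mspace_eq by metis
  with g show "\<exists>g'\<in>carrier A. \<forall>y\<in>topspace X. mdist d (a g y) (a g' y) < e" by blast
qed (use image_in_homeo_group in auto)

lemma homeo_uniformly_continuous:
  assumes "f \<in> carrier (homeo_group X)" "e > 0"
  obtains r where "r > 0" "\<And>y z. \<lbrakk>y \<in> topspace X; z \<in> topspace X; mdist d y z < r\<rbrakk> \<Longrightarrow> mdist d (f y) (f z) < e"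
proof -
  have "continuous_map X X f"
    using assms by (auto simp: carrier_homeo_group homeomorphic_imp_continuous_map)
  then have "uniformly_continuous_map d d f"
    using compact_space metric by (intro continuous_imp_uniformly_continuous_map) simp
  then show thesis
    using that assms(2) mspace_eq unfolding uniformly_continuous_map_def by metis
qed

text \<open>
  Products and inverses of approximants approximate products and inverses, by uniform continuity of
  the homeomorphisms.
\<close>

lemma P_subgroup: "subgroup (carrier P) (homeo_group X)"
proof -
  interpret H: homeo_action "homeo_group X" X "\<lambda>f. f" by (rule homeo_action_homeo_group)
  interpret M: Metric_space "mspace d" "mdist d" by simp
  show ?thesis
  proof (rule H.subgroupI)
    show "carrier P \<subseteq> carrier (homeo_group X)" using in_P_iff by blast
    show "carrier P \<noteq> {}" using image_in_P by blast
  next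
    fix f assume f: "f \<in> carrier P"
    then have fH: "f \<in> carrier (homeo_group X)" by (simp add: in_P_iff)
    let ?f' = "inv\<^bsub>homeo_group X\<^esub> f"
    have f'H: "?f' \<in> carrier (homeo_group X)" using fH by simp
    show "?f' \<in> carrier P"
      unfolding in_P_iff
    proof (intro conjI f'H allI impI)
      fix e :: real assume "e > 0"
      then obtain r where r: "r > 0"
        "\<And>y z. \<lbrakk>y \<in> topspace X; z \<in> topspace X; mdist d y z < r\<rbrakk> \<Longrightarrow> mdist d (?f' y) (?f' z) < e"
        using homeo_uniformly_continuous [OF f'H] by blast
      obtain g where g: "g \<in> carrier A" "\<forall>y\<in>topspace X. mdist d (f y) (a g y) < r"
        using f r(1) unfolding in_P_iff by blast
      have "mdist d (?f' y) (a (inv g) y) < e" if y: "y \<in> topspace X" for y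
      proof -
        define z where "z = a (inv g) y"
        have z: "z \<in> topspace X" "y = a g z" using g y act_closed act_inv2 z_def by auto
        have "mdist d (f z) (a g z) < r" using g z by blast
        then have "mdist d (?f' (a g z)) (?f' (f z)) < e"
          using r(2) [of "a g z" "f z"] z g act_closed H.act_closed [OF fH] M.commute by metis
        then show ?thesis
          unfolding H.act_inv1 [OF fH z(1)] z(2) [symmetric] by (simp add: z_def)
      qed
      then show "\<exists>g\<in>carrier A. \<forall>y\<in>topspace X. mdist d (?f' y) (a g y) < e"
        using g by blast
    qed
  next
    fix f k assume f: "f \<in> carrier P" and k: "k \<in> carrier P"
    then have fH: "f \<in> carrier (homeo_group X)" and kH: "k \<in> carrier (homeo_group X)"
      by (auto simp: in_P_iff)
    show "f \<otimes>\<^bsub>homeo_group X\<^esub> k \<in> carrier P"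
      unfolding in_P_iff
    proof (intro conjI allI impI)
      show "f \<otimes>\<^bsub>homeo_group X\<^esub> k \<in> carrier (homeo_group X)" using fH kH by simp
      fix e :: real assume e: "e > 0"
      then obtain r where r: "r > 0"
        "\<And>y z. \<lbrakk>y \<in> topspace X; z \<in> topspace X; mdist d y z < r\<rbrakk> \<Longrightarrow> mdist d (f y) (f z) < e / 2"
        using homeo_uniformly_continuous [OF fH, of "e / 2"] by auto
      obtain g where g: "g \<in> carrier A" "\<forall>y\<in>topspace X. mdist d (f y) (a g y) < e / 2"
        using f e unfolding in_P_iff by (meson half_gt_zero)
      obtain g' where g': "g' \<in> carrier A" "\<forall>y\<in>topspace X. mdist d (k y) (a g' y) < r"
        using k r(1) unfolding in_P_iff by blast
      have "mdist d ((f \<otimes>\<^bsub>homeo_group X\<^esub> k) y) (a (g \<otimes> g') y) < e" if y: "y \<in> topspace X" for y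
      proof -
        have ky: "k y \<in> topspace X" "a g' y \<in> topspace X"
          using y H.act_closed [OF kH] act_closed [OF g'(1)] by auto
        have "mdist d (f (k y)) (f (a g' y)) < e / 2" using r(2) ky g' y by blast
        moreover have "mdist d (f (a g' y)) (a g (a g' y)) < e / 2" using g ky by blast
        moreover have "mdist d (f (k y)) (a g (a g' y)) \<le>
            mdist d (f (k y)) (f (a g' y)) + mdist d (f (a g' y)) (a g (a g' y))"
          using ky g H.act_closed [OF fH] act_closed mspace_eq by (intro M.triangle) auto
        ultimately show ?thesis
          using H.act_mult [OF fH kH y] act_mult [OF g(1) g'(1) y] by simp
      qed
      then show "\<exists>g\<in>carrier A. \<forall>y\<in>topspace X. mdist d ((f \<otimes>\<^bsub>homeo_group X\<^esub> k) y) (a g y) < e"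
        using g g' by blast
    qed
  qed
qed

lemma top_action_P: "top_action P X (\<lambda>f. f)"
  using top_action_subgroup [OF P_subgroup] by (simp add: profinite_closure_def metric)

lemma homeo_action_P: "homeo_action P X (\<lambda>f. f)"
  using top_action_P by (simp add: homeo_action_def homeo_action_axioms_def top_action_def)

lemma clopen_separated:
  assumes "openin X V" "closedin X V"
  obtains e where "e > 0"
    "\<And>y z. \<lbrakk>y \<in> topspace X; z \<in> topspace X; mdist d y z < e\<rbrakk> \<Longrightarrow> y \<in> V \<longleftrightarrow> z \<in> V"
proof -
  interpret M: Metric_space "mspace d" "mdist d" by simp
  have X: "M.mtopology = X" using metric by (simp add: mtopology_of_def)
  have "\<exists>e>0. \<forall>y\<in>topspace X. \<exists>W\<in>{V, topspace X - V}. M.mball y e \<subseteq> W"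
  proof (rule M.lebesgue_number)
    show "compactin M.mtopology (topspace X)"
      using compact_space X by (simp add: compact_space_def)
    show "openin M.mtopology W" if "W \<in> {V, topspace X - V}" for W
      using that assms X by (auto simp: openin_diff)
  qed auto
  then obtain e where e: "e > 0"
    "\<And>y. y \<in> topspace X \<Longrightarrow> M.mball y e \<subseteq> V \<or> M.mball y e \<subseteq> topspace X - V"
    by auto
  have "y \<in> V \<longleftrightarrow> z \<in> V" if "y \<in> topspace X" "z \<in> topspace X" "mdist d y z < e" for y z
  proof -
    have "y \<in> M.mball y e" "z \<in> M.mball y e"
      using that e(1) mspace_eq by (metis M.centre_in_mball_iff, metis M.in_mball)
    then show ?thesis using e(2) [OF that(1)] by blast
  qed
  with e show thesis using that by blast
qed

text \<open>
  Elements of the profinite closure are approximated by group elements that treat a given clopen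
  set in the same way.
\<close>

lemma P_approximates_on_clopen:
  assumes f: "f \<in> carrier P" and V: "openin X V" "closedin X V" and e: "e > 0"
  obtains g where "g \<in> carrier A" "\<And>y. y \<in> topspace X \<Longrightarrow> f y \<in> V \<longleftrightarrow> a g y \<in> V"
    "\<And>y. y \<in> topspace X \<Longrightarrow> mdist d (f y) (a g y) < e"
proof -
  interpret H: homeo_action "homeo_group X" X "\<lambda>f. f" by (rule homeo_action_homeo_group)
  obtain r where r: "r > 0"
    "\<And>y z. \<lbrakk>y \<in> topspace X; z \<in> topspace X; mdist d y z < r\<rbrakk> \<Longrightarrow> y \<in> V \<longleftrightarrow> z \<in> V"
    using clopen_separated V by blast
  have fH: "f \<in> carrier (homeo_group X)" using f by (simp add: in_P_iff)
  obtain g where g: "g \<in> carrier A" "\<forall>y\<in>topspace X. mdist d (f y) (a g y) < min r e"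
    using f r(1) e unfolding in_P_iff by (meson min_less_iff_conj)
  show thesis
  proof (rule that [OF g(1)])
    fix y assume y: "y \<in> topspace X"
    then have "mdist d (f y) (a g y) < min r e" using g by blast
    then show "f y \<in> V \<longleftrightarrow> a g y \<in> V" "mdist d (f y) (a g y) < e"
      using r(2) H.act_closed [OF fH y] act_closed [OF g(1) y] by auto
  qed
qed

end

context homeo_action
begin

lemma image_eq_iff:
  assumes "g \<in> carrier A" "V \<subseteq> topspace X"
  shows "a g ` V = V \<longleftrightarrow> (\<forall>y\<in>topspace X. a g y \<in> V \<longleftrightarrow> y \<in> V)"
proof
  assume *: "a g ` V = V"
  show "\<forall>y\<in>topspace X. a g y \<in> V \<longleftrightarrow> y \<in> V"
  proof
    fix y assume y: "y \<in> topspace X"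
    have "y \<in> V" if "a g y \<in> V"
    proof -
      obtain z where "z \<in> V" "a g y = a g z" using * \<open>a g y \<in> V\<close> by blast
      then show ?thesis using act_inj assms y by blast
    qed
    then show "a g y \<in> V \<longleftrightarrow> y \<in> V" using * by blast
  qed
next
  assume *: "\<forall>y\<in>topspace X. a g y \<in> V \<longleftrightarrow> y \<in> V"
  have "y \<in> a g ` V" if "y \<in> V" for y
  proof -
    have "y \<in> topspace X" using that assms by blast
    then have "a g (a (inv g) y) = y" "a (inv g) y \<in> topspace X"
      using assms act_inv2 act_closed by auto
    then show ?thesis using * that by (metis image_eqI)
  qed
  then show "a g ` V = V" using * assms by blast
qed

end

context metric_homeo_action
begin

lemma adapted_in_P:
  assumes V: "adapted V"
  shows "adapted_set P X (\<lambda>f. f) V"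
proof -
  interpret P: homeo_action P X "\<lambda>f. f" by (rule homeo_action_P)
  have VX: "V \<subseteq> topspace X" "openin X V" "closedin X V"
    using V adapted_subset by (auto simp: adapted_set_def)
  have "f ` V = V \<or> f ` V \<inter> V = {}" if f: "f \<in> carrier P" for f
  proof -
    obtain g where g: "g \<in> carrier A" "\<And>y. y \<in> topspace X \<Longrightarrow> f y \<in> V \<longleftrightarrow> a g y \<in> V"
      "\<And>y. y \<in> topspace X \<Longrightarrow> mdist d (f y) (a g y) < 1"
      by (rule P_approximates_on_clopen [OF f VX(2,3) zero_less_one]) (rule that)
    consider "a g ` V = V" | "a g ` V \<inter> V = {}" using V g(1) by (auto simp: adapted_set_def)
    then show ?thesis
    proof cases
      case 1
      then have "f ` V = V"
        unfolding P.image_eq_iff [OF f VX(1)] image_eq_iff [OF g(1) VX(1)] using g(2) by simp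
      then show ?thesis ..
    next
      case 2
      then have "f ` V \<inter> V = {}" using g(2) VX(1) by blast
      then show ?thesis ..
    qed
  qed
  then show ?thesis using V by (simp add: adapted_set_def)
qed

text \<open>
  The closure of the stabilizer of \<open>U l\<close> is its stabilizer in the profinite closure: an element close
  enough to \<open>f\<close> stabilizes the clopen set \<open>U l\<close> if and only if \<open>f\<close> does.
\<close>

lemma profinite_level_eq:
  assumes V: "openin X (U l)" "closedin X (U l)"
  shows "profinite_level d A a U l = set_stabilizer P (\<lambda>f. f) (U l)"
proof -
  interpret P: homeo_action P X "\<lambda>f. f" by (rule homeo_action_P)
  have VX: "U l \<subseteq> topspace X" using V openin_subset by blast
  have sub: "a ` stab (U l) \<subseteq> carrier (homeo_group X)" "a ` stab (U l) \<subseteq> carrier P"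
    using image_in_homeo_group image_in_P by (auto simp: set_stabilizer_def)
  have "profinite_level d A a U l = carrier P \<inter> uniform_topology d closure_of (a ` stab (U l))"
    unfolding profinite_level_def closure_of_subtopology using sub(2) by (simp add: Int_absorb1)
  also have "\<dots> = set_stabilizer P (\<lambda>f. f) (U l)"
  proof (intro equalityI subsetI)
    fix f assume f: "f \<in> carrier P \<inter> uniform_topology d closure_of (a ` stab (U l))"
    interpret H: homeo_action "homeo_group X" X "\<lambda>f. f" by (rule homeo_action_homeo_group)
    have fH: "f \<in> carrier (homeo_group X)" using f in_P_iff by blast
    obtain r where r: "r > 0"
      "\<And>y z. \<lbrakk>y \<in> topspace X; z \<in> topspace X; mdist d y z < r\<rbrakk> \<Longrightarrow> y \<in> U l \<longleftrightarrow> z \<in> U l"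
      using clopen_separated V by blast
    obtain g where g: "g \<in> stab (U l)" "\<forall>y\<in>topspace X. mdist d (f y) (a g y) < r"
      using f r(1) in_uniform_closure_iff [OF sub(1)] by auto
    then have gA: "g \<in> carrier A" "a g ` U l = U l" by (auto simp: set_stabilizer_def)
    have "f y \<in> U l \<longleftrightarrow> y \<in> U l" if y: "y \<in> topspace X" for y
      using r(2) [OF H.act_closed [OF fH y] act_closed [OF gA(1) y]] g(2) y
        image_eq_iff [OF gA(1) VX] gA(2) by blast
    then have "f ` U l = U l" using f P.image_eq_iff [OF _ VX, of f] by blast
    then show "f \<in> set_stabilizer P (\<lambda>f. f) (U l)" using f by (simp add: set_stabilizer_def)
  next
    fix f assume f: "f \<in> set_stabilizer P (\<lambda>f. f) (U l)"
    then have fP: "f \<in> carrier P" "f ` U l = U l" by (auto simp: set_stabilizer_def)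
    have "\<exists>g\<in>a ` stab (U l). \<forall>y\<in>topspace X. mdist d (f y) (g y) < e" if "e > 0" for e
    proof -
      obtain g where g: "g \<in> carrier A" "\<And>y. y \<in> topspace X \<Longrightarrow> f y \<in> U l \<longleftrightarrow> a g y \<in> U l"
        "\<And>y. y \<in> topspace X \<Longrightarrow> mdist d (f y) (a g y) < e"
        using P_approximates_on_clopen [OF fP(1) V \<open>e > 0\<close>] by blast
      have "a g ` U l = U l"
        using fP(2) g(2) unfolding P.image_eq_iff [OF fP(1) VX] image_eq_iff [OF g(1) VX] by simp
      then have "g \<in> stab (U l)" using g(1) by (simp add: set_stabilizer_def)
      then show ?thesis using g(3) by blast
    qed
    then show "f \<in> carrier P \<inter> uniform_topology d closure_of (a ` stab (U l))"
      using fP in_uniform_closure_iff [OF sub(1)] in_P_iff by blast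
  qed
  finally show ?thesis .
qed

end

section \<open>Comparison of an action with its profinite closure\<close>

text \<open>
  An effective minimal action with an adapted neighbourhood basis.  The same \<open>x\<close> and \<open>U\<close> serve for
  the profinite closure; facts about it carry the prefix \<open>P\<close>.
\<close>

locale based_metric_action = based_homeo_action A X a x U + metric_homeo_action A X a d
  for A (structure) and X :: "'c topology" and a x U d +
  assumes effective: "inj_on a (carrier A)"
begin

sublocale P: based_homeo_action P X "\<lambda>f. f" x U
proof -
  interpret P: homeo_action P X "\<lambda>f. f" by (rule homeo_action_P)
  show "based_homeo_action P X (\<lambda>f. f) x U"
  proof unfold_locales
    show "minimal_action P X (\<lambda>f. f)"
      unfolding minimal_action_def
    proof
      fix y assume y: "y \<in> topspace X"
      have "orbit A a y \<subseteq> orbit P (\<lambda>f. f) y" using image_in_P by (auto simp: orbit_def)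
      then have "topspace X \<subseteq> X closure_of orbit P (\<lambda>f. f) y"
        using minimal y closure_of_mono unfolding minimal_action_def by metis
      then show "X closure_of orbit P (\<lambda>f. f) y = topspace X"
        by (simp add: closure_of_subset_topspace subset_antisym)
    qed
    show "adapted_nbhd_basis P X (\<lambda>f. f) x U"
      using basis adapted_in_P by (auto simp: adapted_nbhd_basis_def)
  qed (use compact hausdorff in auto)
qed

lemma profinite_level: "profinite_level d A a U = (\<lambda>l. set_stabilizer P (\<lambda>f. f) (U l))"
  using profinite_level_eq basis_adapted by (auto simp: adapted_set_def)

lemma fixator_P: "h \<in> carrier A \<Longrightarrow> a h \<in> P.fixator V \<longleftrightarrow> h \<in> fixator V"
  using image_in_P by (simp add: P.fixator_def fixator_def)

lemma bounded_P_imp_bounded: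
  assumes "P.bounded_fixators" shows bounded_fixators
proof -
  obtain W where W: "openin X W" "W \<noteq> {}"
    "\<forall>V. openin X V \<and> V \<noteq> {} \<and> V \<subseteq> W \<longrightarrow> P.fixator V \<subseteq> P.fixator W"
    using assms unfolding P.bounded_fixators_def by blast
  have "fixator V \<subseteq> fixator W" if "openin X V" "V \<noteq> {}" "V \<subseteq> W" for V
  proof
    fix h assume h: "h \<in> fixator V"
    then have hA: "h \<in> carrier A" by (simp add: fixator_def)
    then have "a h \<in> P.fixator W" using W(3) that h fixator_P by blast
    then show "h \<in> fixator W" using fixator_P hA by blast
  qed
  then show ?thesis unfolding bounded_fixators_def using W by blast
qed

lemma finite_P_imp_finite:
  assumes "P.finite_fixators" shows finite_fixators
  unfolding finite_fixators_def
proof (intro allI impI)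
  fix V assume "openin X V \<and> V \<noteq> {}"
  then have fin: "finite (P.fixator V)" using assms unfolding P.finite_fixators_def by blast
  have sub: "fixator V \<subseteq> carrier A" by (auto simp: fixator_def)
  then have "a ` fixator V \<subseteq> P.fixator V" using fixator_P by blast
  then have "finite (a ` fixator V)" using fin finite_subset by blast
  then show "finite (fixator V)"
    using inj_on_subset [OF effective sub] finite_imageD by blast
qed

lemma act_mult_P: "g \<in> carrier A \<Longrightarrow> h \<in> carrier A \<Longrightarrow> a (g \<otimes> h) = a g \<otimes>\<^bsub>P\<^esub> a h"
  using top_action metric by (auto simp: top_action_def hom_def profinite_closure_def)

lemma flat_P_imp_flat:
  assumes "P.flat_fixators" shows flat_fixators
  unfolding flat_fixators_def
proof (intro allI impI, elim conjE)
  fix V h assume V: "openin X V" "V \<noteq> {}" and h: "h \<in> fixator V"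
  then have hA: "h \<in> carrier A" by (simp add: fixator_def)
  then have "a h \<in> P.fixator V" using h fixator_P by blast
  then obtain B where B: "B \<subseteq> V" "P.adapted B" "\<forall>g\<in>P.stab B. a h \<otimes>\<^bsub>P\<^esub> g = g \<otimes>\<^bsub>P\<^esub> a h"
    using assms V unfolding P.flat_fixators_def by blast
  have "adapted B" using B(2) image_in_P by (auto simp: adapted_set_def)
  moreover have "h \<otimes> g = g \<otimes> h" if g: "g \<in> stab B" for g
  proof -
    have gA: "g \<in> carrier A" using g by (simp add: set_stabilizer_def)
    have "a g \<in> P.stab B" using g image_in_P by (simp add: set_stabilizer_def)
    then have "a (h \<otimes> g) = a (g \<otimes> h)" using B(3) act_mult_P hA gA by simp
    then show ?thesis using effective hA gA by (simp add: inj_on_eq_iff)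
  qed
  ultimately show "\<exists>B\<subseteq>V. adapted B \<and> (\<forall>g\<in>stab B. h \<otimes> g = g \<otimes> h)" using B(1) by blast
qed

lemma stable_action_iff: "stable_action d A a \<longleftrightarrow> P.bounded_fixators"
  unfolding stable_action_def using metric by (rule P.lqa_iff_bounded_fixators)

end

section \<open>Conjugacy invariance of the countable types\<close>

context based_homeo_action
begin

text \<open>
  The failure of LQA is already implied by the unboundedness of the stabilizer chain, so the metric
  plays no role.
\<close>

lemma countable_types:
  assumes "mtopology_of d = X"
  shows "countably_wild_finite_type d A a x U \<longleftrightarrow> finite_type_chain A a x (\<lambda>l. stab (U l))"
    and "countably_wild_flat_type d A a x U \<longleftrightarrow> flat_type_chain A a x (\<lambda>l. stab (U l))"
    and "countably_dynamically_wild d A a x U \<longleftrightarrow> dynamical_type_chain A a x (\<lambda>l. stab (U l))"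
  unfolding countably_wild_finite_type_def countably_wild_flat_type_def
    countably_dynamically_wild_def lqa_iff_bounded_fixators [OF assms]
    finite_type_iff flat_type_iff dynamical_type_iff
  by blast+

end

text \<open>
  Two actions of one group, with an equivariant homeomorphism \<open>h\<close> from the second space onto the
  first.
\<close>

locale conjugate_homeo_actions =
  A: homeo_action A X a + B: homeo_action A X' b
  for A (structure) and X :: "'c topology" and a and X' :: "'d topology" and b +
  fixes h :: "'d \<Rightarrow> 'c"
  assumes conj_map: "homeomorphic_map X' X h"
    and equivariant: "\<And>g z. \<lbrakk>g \<in> carrier A; z \<in> topspace X'\<rbrakk> \<Longrightarrow> h (b g z) = a g (h z)"
begin

lemma inj: "inj_on h (topspace X')"
  using conj_map by (rule homeomorphic_imp_injective_map)

lemma surj: "h ` topspace X' = topspace X"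
  using conj_map by (rule homeomorphic_imp_surjective_map)

lemma image_equivariant:
  "g \<in> carrier A \<Longrightarrow> V \<subseteq> topspace X' \<Longrightarrow> h ` b g ` V = a g ` h ` V"
  by (force simp: equivariant subset_iff image_iff)

lemma stab_conjugate:
  assumes "V \<subseteq> topspace X'"
  shows "set_stabilizer A b V = set_stabilizer A a (h ` V)"
proof -
  have "b g ` V = V \<longleftrightarrow> a g ` h ` V = h ` V" if "g \<in> carrier A" for g
    using inj_on_image_eq_iff [OF inj B.image_subset [OF that assms] assms]
    by (simp add: image_equivariant [OF that assms])
  then show ?thesis unfolding set_stabilizer_def by blast
qed

lemma point_stab_conjugate:
  assumes "z \<in> topspace X'"
  shows "stabilizer A b z = stabilizer A a (h z)"
proof -
  have "b g z = z \<longleftrightarrow> a g (h z) = h z" if "g \<in> carrier A" for g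
    using inj_on_eq_iff [OF inj B.act_closed [OF that assms] assms] equivariant [OF that assms]
    by simp
  then show ?thesis by (auto simp: stabilizer_def)
qed

lemma adapted_conjugate:
  assumes "B.adapted V"
  shows "A.adapted (h ` V)"
proof -
  have V: "V \<subseteq> topspace X'" "openin X' V" "closedin X' V" "V \<noteq> {}"
    using assms B.adapted_subset by (auto simp: adapted_set_def)
  have "a g ` h ` V = h ` V \<or> a g ` h ` V \<inter> h ` V = {}" if g: "g \<in> carrier A" for g
  proof -
    consider "b g ` V = V" | "b g ` V \<inter> V = {}" using assms g by (auto simp: adapted_set_def)
    then show ?thesis
    proof cases
      case 1
      then show ?thesis using image_equivariant [OF g V(1)] by simp
    next
      case 2
      then have "h ` b g ` V \<inter> h ` V = {}"
        using inj_on_image_Int [OF inj B.image_subset [OF g V(1)] V(1)] by simp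
      then show ?thesis using image_equivariant [OF g V(1)] by simp
    qed
  qed
  then show ?thesis
    using V homeomorphic_map_openness [OF conj_map V(1)] homeomorphic_map_closedness [OF conj_map V(1)]
    by (simp add: adapted_set_def)
qed

lemma basis_conjugate:
  assumes basis: "adapted_nbhd_basis A X' b z W"
  shows "adapted_nbhd_basis A X a (h z) (\<lambda>l. h ` W l)"
proof -
  have ad: "B.adapted (W l)" "z \<in> W l" "W (Suc l) \<subset> W l" for l
    using basis by (auto simp: adapted_nbhd_basis_def)
  have sub: "W l \<subseteq> topspace X'" for l using ad B.adapted_subset by blast
  have "h ` W (Suc l) \<subset> h ` W l" for l
    using ad(3) [of l] inj_on_image_eq_iff [OF inj sub sub, of "Suc l" l] by blast
  moreover have "(\<Inter>l. h ` W l) = h ` (\<Inter>l. W l)"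
    using sub by (intro image_INT [OF inj, symmetric]) auto
  ultimately show ?thesis
    using basis surj adapted_conjugate ad by (simp add: adapted_nbhd_basis_def)
qed

lemma minimal_conjugate:
  assumes "minimal_action A X a"
  shows "minimal_action A X' b"
  unfolding minimal_action_def
proof
  fix z assume z: "z \<in> topspace X'"
  have O: "orbit A b z \<subseteq> topspace X'" using B.act_closed z by (auto simp: orbit_def)
  have "h ` orbit A b z = orbit A a (h z)"
    using equivariant z by (force simp: orbit_def)
  moreover have "X closure_of orbit A a (h z) = topspace X"
    using assms z surj unfolding minimal_action_def by blast
  ultimately have "h ` (X' closure_of orbit A b z) = h ` topspace X'"
    using homeomorphic_map_closure_of [OF conj_map O] surj by simp
  then show "X' closure_of orbit A b z = topspace X'"
    using inj_on_image_eq_iff [OF inj closure_of_subset_topspace order_refl] by blast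
qed

text \<open>
  A conjugacy preserves setwise and point stabilizers as subgroups of the acting group, so the
  chains of the two actions are literally equal.
\<close>

lemma types_conjugate:
  assumes z: "z \<in> topspace X'" and W: "\<And>l. W l \<subseteq> topspace X'"
  shows "finite_type_chain A b z (\<lambda>l. B.stab (W l)) \<longleftrightarrow>
           finite_type_chain A a (h z) (\<lambda>l. A.stab (h ` W l))"
    and "flat_type_chain A b z (\<lambda>l. B.stab (W l)) \<longleftrightarrow>
           flat_type_chain A a (h z) (\<lambda>l. A.stab (h ` W l))"
    and "dynamical_type_chain A b z (\<lambda>l. B.stab (W l)) \<longleftrightarrow>
           dynamical_type_chain A a (h z) (\<lambda>l. A.stab (h ` W l))"
proof -
  have "(\<lambda>l. B.stab (W l)) = (\<lambda>l. A.stab (h ` W l))" using stab_conjugate W by blast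
  then have "stab_level A b z (\<lambda>l. B.stab (W l)) = stab_level A a (h z) (\<lambda>l. A.stab (h ` W l))"
    "cent_level A b z (\<lambda>l. B.stab (W l)) = cent_level A a (h z) (\<lambda>l. A.stab (h ` W l))"
    using point_stab_conjugate [OF z] by (simp_all add: stab_level_def cent_level_def fun_eq_iff)
  then show "finite_type_chain A b z (\<lambda>l. B.stab (W l)) \<longleftrightarrow>
           finite_type_chain A a (h z) (\<lambda>l. A.stab (h ` W l))"
    and "flat_type_chain A b z (\<lambda>l. B.stab (W l)) \<longleftrightarrow>
           flat_type_chain A a (h z) (\<lambda>l. A.stab (h ` W l))"
    and "dynamical_type_chain A b z (\<lambda>l. B.stab (W l)) \<longleftrightarrow>
           dynamical_type_chain A a (h z) (\<lambda>l. A.stab (h ` W l))"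
    by (simp_all add: finite_type_chain_def flat_type_chain_def dynamical_type_chain_def)
qed

end

lemma (in based_homeo_action) countable_types_invariant:
  fixes X' :: "'d topology"
  assumes d: "mtopology_of d = X" and d': "mtopology_of d' = X'" and b: "top_action A X' b"
    and conj: "conjugate_actions A X a X' b" and basis': "adapted_nbhd_basis A X' b x' U'"
  shows "countably_wild_finite_type d A a x U \<longleftrightarrow> countably_wild_finite_type d' A b x' U'"
    and "countably_wild_flat_type d A a x U \<longleftrightarrow> countably_wild_flat_type d' A b x' U'"
    and "countably_dynamically_wild d A a x U \<longleftrightarrow> countably_dynamically_wild d' A b x' U'"
proof -
  obtain h where h: "homeomorphic_map X' X h"
    "\<forall>z\<in>topspace X'. \<forall>g\<in>carrier A. h (b g z) = a g (h z)"
    using conj unfolding conjugate_actions_def by blast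
  interpret C: conjugate_homeo_actions A X a X' b h
    by unfold_locales (use b h in auto)
  interpret B: based_homeo_action A X' b x' U'
  proof unfold_locales
    have "X' homeomorphic_space X" using h(1) homeomorphic_map_imp_homeomorphic_space by blast
    then show "compact_space X'" using compact homeomorphic_compact_space by blast
    show "Hausdorff_space X'"
      using d' Metric_space.Hausdorff_space_mtopology [OF Metric_space_mspace_mdist, of d']
      by (simp add: mtopology_of_def)
  qed (use C.minimal_conjugate minimal basis' in auto)
  interpret A': based_homeo_action A X a "h x'" "\<lambda>l. h ` U' l"
    by unfold_locales (rule C.basis_conjugate [OF basis'])
  note conj_types = C.types_conjugate [of x' U', OF B.base_in_space B.basis_subset]
  show "countably_wild_finite_type d A a x U \<longleftrightarrow> countably_wild_finite_type d' A b x' U'"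
    "countably_wild_flat_type d A a x U \<longleftrightarrow> countably_wild_flat_type d' A b x' U'"
    "countably_dynamically_wild d A a x U \<longleftrightarrow> countably_dynamically_wild d' A b x' U'"
    unfolding countable_types [OF d] B.countable_types [OF d'] conj_types
      finite_type_iff A'.finite_type_iff flat_type_iff A'.flat_type_iff
      dynamical_type_iff A'.dynamical_type_iff
    by (rule refl)+
qed

section \<open>Invariance and comparison of the types of wildness\<close>

context based_metric_action
begin

lemma wild_types:
  shows "wild_finite_type d A a x U \<longleftrightarrow> \<not> P.bounded_fixators \<and> P.finite_fixators"
    and "wild_flat_type d A a x U \<longleftrightarrow> \<not> P.bounded_fixators \<and> P.flat_fixators"
    and "dynamically_wild d A a x U \<longleftrightarrow> \<not> P.bounded_fixators \<and> \<not> P.flat_fixators"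
  unfolding wild_finite_type_def wild_flat_type_def dynamically_wild_def stable_action_iff
    profinite_level P.finite_type_iff P.flat_type_iff P.dynamical_type_iff
  by blast+

end
theorem theorem1p3:
  fixes G :: "('g, 'm) monoid_scheme"
    and X :: "'a topology" and d :: "'a metric"
    and \<Phi> :: "'g \<Rightarrow> 'a \<Rightarrow> 'a"
    and x :: 'a and U :: "nat \<Rightarrow> 'a set"
  assumes "group G" and "countable (carrier G)"
    and "cantor_space X" and "mtopology_of d = X"
    and "top_action G X \<Phi>"
    and "effective_action G \<Phi>"
    and "minimal_action G X \<Phi>"
    and "equicontinuous_action G X \<Phi>"
    and "x \<in> topspace X"
    and "adapted_nbhd_basis G X \<Phi> x U"
  shows
    "(\<forall>(X' :: 'c topology) d' \<Psi> x' U'.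
        mtopology_of d' = X' \<and> top_action G X' \<Psi> \<and> conjugate_actions G X \<Phi> X' \<Psi> \<and>
        x' \<in> topspace X' \<and> adapted_nbhd_basis G X' \<Psi> x' U' \<longrightarrow>
          (countably_wild_finite_type d G \<Phi> x U \<longleftrightarrow> countably_wild_finite_type d' G \<Psi> x' U') \<and>
          (countably_wild_flat_type d G \<Phi> x U \<longleftrightarrow> countably_wild_flat_type d' G \<Psi> x' U') \<and>
          (countably_dynamically_wild d G \<Phi> x U \<longleftrightarrow> countably_dynamically_wild d' G \<Psi> x' U'))
     \<and> (countably_wild_flat_type d G \<Phi> x U \<longrightarrow>
          Hausdorff_space (germinal_groupoid_topology G X \<Phi>))
     \<and> ((\<exists>g. non_Hausdorff_element G X \<Phi> g) \<longrightarrow> countably_dynamically_wild d G \<Phi> x U)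
     \<and> (countably_dynamically_wild d G \<Phi> x U \<longrightarrow> dynamically_wild d G \<Phi> x U)
     \<and> (wild_finite_type d G \<Phi> x U \<longrightarrow> lqa d G \<Phi> \<or> countably_wild_finite_type d G \<Phi> x U)
     \<and> (wild_flat_type d G \<Phi> x U \<longrightarrow> lqa d G \<Phi> \<or> countably_wild_flat_type d G \<Phi> x U)"
proof -
  interpret based_metric_action G X \<Phi> x U d
  proof -
    interpret group G by (rule assms(1))
    have "Hausdorff_space X"
      using assms(4) Metric_space.Hausdorff_space_mtopology [OF Metric_space_mspace_mdist, of d]
      by (simp add: mtopology_of_def)
    then show "based_metric_action G X \<Phi> x U d"
      using assms by unfold_locales (auto simp: cantor_space_def effective_action_def)
  qed
  note countable = countable_types [OF metric, unfolded finite_type_iff flat_type_iff dynamical_type_iff]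
  have lqa: "lqa d G \<Phi> \<longleftrightarrow> bounded_fixators" using metric by (rule lqa_iff_bounded_fixators)
  have nonH: "\<not> bounded_fixators \<and> \<not> flat_fixators" if "non_Hausdorff_element G X \<Phi> g" for g
    using that non_Hausdorff_imp_not_bounded non_Hausdorff_imp_not_flat
    unfolding non_Hausdorff_element_def by blast
  show ?thesis
  proof (intro conjI)
    show "(\<forall>(X' :: 'c topology) d' \<Psi> x' U'.
        mtopology_of d' = X' \<and> top_action G X' \<Psi> \<and> conjugate_actions G X \<Phi> X' \<Psi> \<and>
        x' \<in> topspace X' \<and> adapted_nbhd_basis G X' \<Psi> x' U' \<longrightarrow>
          (countably_wild_finite_type d G \<Phi> x U \<longleftrightarrow> countably_wild_finite_type d' G \<Psi> x' U') \<and>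
          (countably_wild_flat_type d G \<Phi> x U \<longleftrightarrow> countably_wild_flat_type d' G \<Psi> x' U') \<and>
          (countably_dynamically_wild d G \<Phi> x U \<longleftrightarrow> countably_dynamically_wild d' G \<Psi> x' U'))"
    proof (intro allI impI, elim conjE)
      fix X' :: "'c topology" and d' \<Psi> x' U'
      assume "mtopology_of d' = X'" "top_action G X' \<Psi>" "conjugate_actions G X \<Phi> X' \<Psi>"
        "adapted_nbhd_basis G X' \<Psi> x' U'"
      note inv = countable_types_invariant [OF metric this]
      show "(countably_wild_finite_type d G \<Phi> x U \<longleftrightarrow> countably_wild_finite_type d' G \<Psi> x' U') \<and>
          (countably_wild_flat_type d G \<Phi> x U \<longleftrightarrow> countably_wild_flat_type d' G \<Psi> x' U') \<and>
          (countably_dynamically_wild d G \<Phi> x U \<longleftrightarrow> countably_dynamically_wild d' G \<Psi> x' U')"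
        by (intro conjI inv)
    qed
    show "countably_wild_flat_type d G \<Phi> x U \<longrightarrow> Hausdorff_space (germinal_groupoid_topology G X \<Phi>)"
      unfolding countable using nonH Hausdorff_germinal_groupoid [OF hausdorff] by blast
    show "(\<exists>g. non_Hausdorff_element G X \<Phi> g) \<longrightarrow> countably_dynamically_wild d G \<Phi> x U"
      unfolding countable using nonH by blast
    show "countably_dynamically_wild d G \<Phi> x U \<longrightarrow> dynamically_wild d G \<Phi> x U"
      unfolding countable wild_types using bounded_P_imp_bounded flat_P_imp_flat by blast
    show "wild_finite_type d G \<Phi> x U \<longrightarrow> lqa d G \<Phi> \<or> countably_wild_finite_type d G \<Phi> x U"
      unfolding countable wild_types lqa using finite_P_imp_finite by blast
    show "wild_flat_type d G \<Phi> x U \<longrightarrow> lqa d G \<Phi> \<or> countably_wild_flat_type d G \<Phi> x U"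
      unfolding countable wild_types lqa using flat_P_imp_flat by blast
  qed
qed

end
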